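(* For any two predicates $P,Q$ and any concrete program $S$, if $\models_{\mathrm{par}}\{P\}\,S\,\{Q\}$, then $\{P\}\,\square\,\{Q\}\hookrightarrow_{\mathrm{par}}^{*}S$.
   Context: Quantum setting. There is a finite set $\mathrm{qVars}$ of quantum variables; each $q$ has Hilbert space $\mathcal H_q=\mathbb C^{\Sigma_q}$ ($\Sigma_q$ finite) with standard orthonormal basis $\{|x\rangle\}_{x\in\Sigma_q}$. For a set $\vec q\subseteq\mathrm{qVars}$, $\mathcal H_{\vec q}=\bigotimes_{q\in\vec q}\mathcal H_q$ with standard basis labelled by $\Sigma_{\vec q}=\prod_{q\in\vec q}\Sigma_q$, and $\mathcal H=\mathcal H_{\mathrm{qVars}}$. For an operator $A$ on $\mathcal H_{\vec q}$, $A_{\vec q}=A\otimes I$ on $\mathcal H$. $\preceq$ is the Löwner order. A partial state is a positive semidefinite (PSD) $\rho$ on $\mathcal H$ with $\operatorname{tr}\rho\le1$. A predicate is an operator $P$ on $\mathcal H$ with $0\preceq P\preceq I$; "$P\Rightarrow Q$" means $P\preceq Q$. A measurement on $\vec q$ is a family $\vec M=\{M_\omega\}_{\omega\in\Omega}$ ($\Omega$ finite) of PSD operators on $\mathcal H_{\vec q}$ with $\sum_\omega M_\omega=I$; write $\mathcal M_{\omega}(X)=\sqrt{M_{\omega,\vec q}}\,X\,\sqrt{M_{\omega,\vec q}}$. A binary measurement is given by an operator $B$ on $\mathcal H_{\vec q}$ with $0\preceq B\preceq I$, and $\mathcal B_{0,\vec q}(X)=\sqrt{(I-B)_{\vec q}}\,X\sqrt{(I-B)_{\vec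 q}}$, $\mathcal B_{1,\vec q}(X)=\sqrt{B_{\vec q}}\,X\sqrt{B_{\vec q}}$. Quantum while language: $S::=\mathbf{skip}\mid \vec q:=|0\rangle\mid \vec q\mathrel{*}=U\mid S_1;S_2\mid \mathbf{repeat}\ N\ \mathbf{do}\ S\mid \mathbf{case}\ \vec M[\vec q]\ \mathbf{of}\ \{\omega: S_\omega\}_{\omega\in\Omega}\mid \mathbf{while}\ B[\vec q]\ \mathbf{do}\ S$, with $U$ unitary on $\mathcal H_{\vec q}$, $N\in\mathbb N$. Denotational semantics $[\![S]\!]$ on partial states: $[\![\mathbf{skip}]\!](\rho)=\rho$; $[\![\vec q:=|0\rangle]\!](\rho)=\sum_{x\in\Sigma_{\vec q}}|0\rangle\langle x|_{\vec q}\,\rho\,|x\rangle\langle0|_{\vec q}$; $[\![\vec q\mathrel{*}=U]\!](\rho)=U_{\vec q}\rho U_{\vec q}^\dagger$; $[\![S_1;S_2]\!]=[\![S_2]\!]\circ[\![S_1]\!]$; $[\![\mathbf{repeat}\ N\ \mathbf{do}\ S]\!]=[\![S]\!]^N$; $[\![\mathbf{case}\ldots]\!](\rho)=\sum_\omega[\![S_\omega]\!](\mathcal M_\omega(\rho))$; $[\![\mathbf{while}\ B[\vec q]\ \mathbf{do}\ S]\!](\rho)=\sum_{k\ge0}(\mathcal B_{0,\vec q}\circ([\![S]\!]\circ\mathcal B_{1,\vec q})^k)(\rho)$. Hoare triples: $\models_{\mathrm{tot}}\{P\}S\{Q\}$ iff $\operatorname{tr}(P\rho)\le\operatorname{tr}(Q[\![S]\!](\rho))$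 for all partial states $\rho$; $\models_{\mathrm{par}}\{P\}S\{Q\}$ iff $\operatorname{tr}(P\rho)\le\operatorname{tr}(Q[\![S]\!](\rho))+\operatorname{tr}\rho-\operatorname{tr}[\![S]\!](\rho)$ for all partial states $\rho$. Syntactic sugar: $\mathbf{if}\ B[\vec q]\ \mathbf{then}\ S_1\ \mathbf{else}\ S_0$ abbreviates $\mathbf{case}\ \{1:B,0:I-B\}[\vec q]\ \mathbf{of}\ \{1:S_1,0:S_0\}$; omitting else means $S_0=\mathbf{skip}$. Programs with holes. The grammar is extended by holes $\{P\}\,\square\,\{Q\}$ ($P,Q$ predicates); more generally a hole may carry a family of specifications $\{P_\lambda\}\,\square\,\{Q_\lambda\}$, $\lambda\in\Lambda$ (written e.g. $\{P,P'\}\square\{Q,Q'\}$ for two). A program without holes is concrete. A refinement rule applied to a hole with a family must have its side conditions satisfied for every $\lambda$; the predicates it introduces may depend on $\lambda$, but the syntactic program produced (variables, unitaries, measurements, $N$, $B$) is the same for all $\lambda$; holes it creates carry the families indexed by $\lambda$ together with any newly introduced index. Refinement for partial correctness $\hookrightarrow_{\mathrm{par}}$ (for predicates $P,Q$): (H.skip) $\{P\}\square\{Q\}\hookrightarrow\mathbf{skip}$ if $P\Rightarrow Q$; (H.init) $\{P\}\square\{Q\}\hookrightarrow\vec q:=|0\rangle$ if $P\Rightarrow\sum_{x\in\Sigma_{\vec q}}|x\rangle\langle0|_{\vec q}Q|0\rangle\langle x|_{\vec q}$; (H.unit) $\{P\}\square\{Q\}\hookrightarrow\vec q\mathrel{*}=U$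 if $P\Rightarrow U_{\vec q}^\dagger QU_{\vec q}$; (H.seq) $\{P\}\square\{Q\}\hookrightarrow\{P\}\square\{R\};\{R\}\square\{Q\}$ for any predicate $R$; (HP.split) $\{P\}\square\{Q\}\hookrightarrow\{P_\gamma\}\square\{Q_\gamma\}$ ($\gamma\in\Gamma$) if $P\Rightarrow\sum_\gamma p_\gamma P_\gamma$ and $\sum_\gamma p_\gamma Q_\gamma\Rightarrow Q$ for a probability distribution $(p_\gamma)$; (H.repeat) $\{P\}\square\{Q\}\hookrightarrow\mathbf{repeat}\ N\ \mathbf{do}\ \{R_j\}\square\{R_{j+1}\}$ (family over $j\in\{0,\dots,N-1\}$) for predicates $R_0,\dots,R_N$ with $P\Rightarrow R_0$, $R_N\Rightarrow Q$; (H.case) $\{P\}\square\{Q\}\hookrightarrow\mathbf{case}\ \vec M[\vec q]\ \mathbf{of}\ \{\omega:\{P_\omega\}\square\{Q\}\}_{\omega}$ if $P\Rightarrow\sum_\omega\mathcal M_\omega(P_\omega)$; (HP.while) $\{P\}\square\{Q\}\hookrightarrow\mathbf{while}\ B[\vec q]\ \mathbf{do}\ \{R\}\square\{\mathcal B_{0,\vec q}(Q)+\mathcal B_{1,\vec q}(R)\}$ for a predicate $R$ with $P\Rightarrow\mathcal B_{0,\vec q}(Q)+\mathcal B_{1,\vec q}(R)$. Composite rules: (C.seqL/C.seqR/C.repeat/C.case/C.while) if $S'\hookrightarrow S$ then replacing one occurrence of $S'$ as the left or right component of a sequence, the body of a repeat, one branch of a case, or the body of a while by $S$ is a refinement step.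 Refinement for total correctness $\hookrightarrow_{\mathrm{tot}}$ uses all (H.* ) and (C.* ) rules above but replaces (HP.while) by (HT.while): $\{P\}\square\{Q\}\hookrightarrow\mathbf{while}\ B[\vec q]\ \mathbf{do}\ \{R_{n+1}\}\square\{\mathcal B_{0,\vec q}(Q)+\mathcal B_{1,\vec q}(R_n)\}$ (family over $n\in\mathbb N$) for predicates $(R_n)_{n\in\mathbb N}$ with $R_0=0$, $R_n\Rightarrow R_{n+1}$, whose limit $R=\lim_n R_n$ satisfies $P\Rightarrow\mathcal B_{0,\vec q}(Q)+\mathcal B_{1,\vec q}(R)$; and replaces (HP.split) by (HT.split), identical except that $(p_\gamma)$ need only be nonnegative reals. $\hookrightarrow^k$ denotes $k$ steps and $\hookrightarrow^*$ the reflexive-transitive closure. *)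

theory Defs
  imports Complex_Main
begin

text \<open>Quantum variables form a finite type 'v.  The dimension function d gives,
  for every variable q, the finite set of classical values Sigma_q = {0..<d q}.
  A basis state of H_qs (qs a set of variables) is a memory m :: 'v => nat with
  m v < d v for v in qs and m v = 0 outside qs.  Operators (on H or on a
  subsystem H_qs) are represented by their matrices in the standard basis,
  i.e. functions mem => mem => complex; only entries indexed by basis
  states are meaningful.\<close>

type_synonym 'v mem = "'v \<Rightarrow> nat"
type_synonym 'v op = "'v mem \<Rightarrow> 'v mem \<Rightarrow> complex"

definition basis :: "('v \<Rightarrow> nat) \<Rightarrow> 'v set \<Rightarrow> 'v mem set" where
  "basis d qs = {m. \<forall>v. (v \<in> qs \<longrightarrow> m v < d v) \<and> (v \<notin> qs \<longrightarrow> m v = 0)}"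

abbreviation fullb :: "('v \<Rightarrow> nat) \<Rightarrow> 'v mem set" where
  "fullb d \<equiv> basis d UNIV"

definition idop :: "'v op" where
  "idop = (\<lambda>i j. if i = j then 1 else 0)"

definition zeroop :: "'v op" where
  "zeroop = (\<lambda>i j. 0)"

definition addop :: "'v op \<Rightarrow> 'v op \<Rightarrow> 'v op" where
  "addop A B = (\<lambda>i j. A i j + B i j)"

definition subop :: "'v op \<Rightarrow> 'v op \<Rightarrow> 'v op" where
  "subop A B = (\<lambda>i j. A i j - B i j)"

definition scaleop :: "real \<Rightarrow> 'v op \<Rightarrow> 'v op" where
  "scaleop c A = (\<lambda>i j. complex_of_real c * A i j)"

definition sumop :: "'a set \<Rightarrow> ('a \<Rightarrow> 'v op) \<Rightarrow> 'v op" where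
  "sumop X f = (\<lambda>i j. \<Sum>x\<in>X. f x i j)"

definition sumlistop :: "'v op list \<Rightarrow> 'v op" where
  "sumlistop xs = foldr addop xs zeroop"

definition mulB :: "'v mem set \<Rightarrow> 'v op \<Rightarrow> 'v op \<Rightarrow> 'v op" where
  "mulB X A B = (\<lambda>i j. \<Sum>k\<in>X. A i k * B k j)"

abbreviation mul :: "('v \<Rightarrow> nat) \<Rightarrow> 'v op \<Rightarrow> 'v op \<Rightarrow> 'v op" where
  "mul d \<equiv> mulB (fullb d)"

definition adj :: "'v op \<Rightarrow> 'v op" where
  "adj A = (\<lambda>i j. cnj (A j i))"

definition trace :: "('v \<Rightarrow> nat) \<Rightarrow> 'v op \<Rightarrow> complex" where
  "trace d A = (\<Sum>i\<in>fullb d. A i i)"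

definition eq_on :: "'v mem set \<Rightarrow> 'v op \<Rightarrow> 'v op \<Rightarrow> bool" where
  "eq_on X A B \<longleftrightarrow> (\<forall>i\<in>X. \<forall>j\<in>X. A i j = B i j)"

definition psdB :: "'v mem set \<Rightarrow> 'v op \<Rightarrow> bool" where
  "psdB X A \<longleftrightarrow> (\<forall>v :: 'v mem \<Rightarrow> complex.
     Im (\<Sum>i\<in>X. \<Sum>j\<in>X. cnj (v i) * A i j * v j) = 0 \<and>
     0 \<le> Re (\<Sum>i\<in>X. \<Sum>j\<in>X. cnj (v i) * A i j * v j))"

definition loewnerB :: "'v mem set \<Rightarrow> 'v op \<Rightarrow> 'v op \<Rightarrow> bool" where
  "loewnerB X A B \<longleftrightarrow> psdB X (subop B A)"

abbreviation loewner :: "('v \<Rightarrow> nat) \<Rightarrow> 'v op \<Rightarrow> 'v op \<Rightarrow> bool" where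
  "loewner d \<equiv> loewnerB (fullb d)"

definition is_pred :: "('v \<Rightarrow> nat) \<Rightarrow> 'v op \<Rightarrow> bool" where
  "is_pred d P \<longleftrightarrow> loewner d zeroop P \<and> loewner d P idop"

definition partial_state :: "('v \<Rightarrow> nat) \<Rightarrow> 'v op \<Rightarrow> bool" where
  "partial_state d \<rho> \<longleftrightarrow> psdB (fullb d) \<rho> \<and> Re (trace d \<rho>) \<le> 1"

text \<open>The (unique) PSD square root of a PSD operator on H (entries outside
  the basis are fixed to 0 to make it unique).\<close>
definition sqrt_op :: "('v \<Rightarrow> nat) \<Rightarrow> 'v op \<Rightarrow> 'v op" where
  "sqrt_op d M = (THE R. psdB (fullb d) R \<and> eq_on (fullb d) (mul d R R) M \<and>
      (\<forall>i j. i \<notin> fullb d \<or> j \<notin> fullb d \<longrightarrow> R i j = 0))"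

text \<open>Embedding A_qs = A \<otimes> I of an operator A on H_qs into H.\<close>
definition restr :: "'v set \<Rightarrow> 'v mem \<Rightarrow> 'v mem" where
  "restr qs m = (\<lambda>v. if v \<in> qs then m v else 0)"

definition lift :: "'v set \<Rightarrow> 'v op \<Rightarrow> 'v op" where
  "lift qs A = (\<lambda>m m'. if (\<forall>v. v \<notin> qs \<longrightarrow> m v = m' v) then A (restr qs m) (restr qs m') else 0)"

definition ketbra :: "'v mem \<Rightarrow> 'v mem \<Rightarrow> 'v op" where
  "ketbra a b = (\<lambda>i j. if i = a \<and> j = b then 1 else 0)"

definition zeromem :: "'v mem" where
  "zeromem = (\<lambda>v. 0)"

definition sandwich :: "('v \<Rightarrow> nat) \<Rightarrow> 'v op \<Rightarrow> 'v op \<Rightarrow> 'v op" where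
  "sandwich d K X = mul d (mul d K X) K"

definition meas_op :: "('v \<Rightarrow> nat) \<Rightarrow> 'v set \<Rightarrow> 'v op \<Rightarrow> 'v op \<Rightarrow> 'v op" where
  "meas_op d qs M X = sandwich d (sqrt_op d (lift qs M)) X"

definition B0 :: "('v \<Rightarrow> nat) \<Rightarrow> 'v set \<Rightarrow> 'v op \<Rightarrow> 'v op \<Rightarrow> 'v op" where
  "B0 d qs B X = sandwich d (sqrt_op d (lift qs (subop idop B))) X"

definition B1 :: "('v \<Rightarrow> nat) \<Rightarrow> 'v set \<Rightarrow> 'v op \<Rightarrow> 'v op \<Rightarrow> 'v op" where
  "B1 d qs B X = sandwich d (sqrt_op d (lift qs B)) X"

definition init_op :: "('v \<Rightarrow> nat) \<Rightarrow> 'v set \<Rightarrow> 'v op \<Rightarrow> 'v op" where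
  "init_op d qs X = sumop (basis d qs)
     (\<lambda>x. mul d (mul d (lift qs (ketbra zeromem x)) X) (lift qs (ketbra x zeromem)))"

definition init_pre :: "('v \<Rightarrow> nat) \<Rightarrow> 'v set \<Rightarrow> 'v op \<Rightarrow> 'v op" where
  "init_pre d qs X = sumop (basis d qs)
     (\<lambda>x. mul d (mul d (lift qs (ketbra x zeromem)) X) (lift qs (ketbra zeromem x)))"

definition unit_op :: "('v \<Rightarrow> nat) \<Rightarrow> 'v set \<Rightarrow> 'v op \<Rightarrow> 'v op \<Rightarrow> 'v op" where
  "unit_op d qs U X = mul d (mul d (lift qs U) X) (adj (lift qs U))"

text \<open>A case statement is given by the list of pairs (M_omega, S_omega);
  Omega is the index set of the list.  A hole carries the set of its
  specifications {P_lambda} [] {Q_lambda}.\<close>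

datatype 'v prog =
    Skip
  | Init "'v set"
  | Unit "'v set" "'v op"
  | Seq "'v prog" "'v prog"
  | Repeat nat "'v prog"
  | Case "'v set" "('v op \<times> 'v prog) list"
  | While "'v set" "'v op" "'v prog"
  | Hole "('v op \<times> 'v op) set"

fun concrete :: "'v prog \<Rightarrow> bool" where
  "concrete Skip = True"
| "concrete (Init qs) = True"
| "concrete (Unit qs U) = True"
| "concrete (Seq S1 S2) = (concrete S1 \<and> concrete S2)"
| "concrete (Repeat N S) = concrete S"
| "concrete (Case qs cs) = (\<forall>c\<in>set cs. concrete (snd c))"
| "concrete (While qs B S) = concrete S"
| "concrete (Hole F) = False"

definition unitary_on :: "('v \<Rightarrow> nat) \<Rightarrow> 'v set \<Rightarrow> 'v op \<Rightarrow> bool" where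
  "unitary_on d qs U \<longleftrightarrow> eq_on (basis d qs) (mulB (basis d qs) (adj U) U) idop \<and>
                          eq_on (basis d qs) (mulB (basis d qs) U (adj U)) idop"

definition measurement_on :: "('v \<Rightarrow> nat) \<Rightarrow> 'v set \<Rightarrow> 'v op list \<Rightarrow> bool" where
  "measurement_on d qs Ms \<longleftrightarrow> (\<forall>M\<in>set Ms. psdB (basis d qs) M) \<and>
                              eq_on (basis d qs) (sumlistop Ms) idop"

definition binary_on :: "('v \<Rightarrow> nat) \<Rightarrow> 'v set \<Rightarrow> 'v op \<Rightarrow> bool" where
  "binary_on d qs B \<longleftrightarrow> loewnerB (basis d qs) zeroop B \<and> loewnerB (basis d qs) B idop"

fun wf_prog :: "('v \<Rightarrow> nat) \<Rightarrow> 'v prog \<Rightarrow> bool" where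
  "wf_prog d Skip = True"
| "wf_prog d (Init qs) = True"
| "wf_prog d (Unit qs U) = unitary_on d qs U"
| "wf_prog d (Seq S1 S2) = (wf_prog d S1 \<and> wf_prog d S2)"
| "wf_prog d (Repeat N S) = wf_prog d S"
| "wf_prog d (Case qs cs) = (measurement_on d qs (map fst cs) \<and> (\<forall>c\<in>set cs. wf_prog d (snd c)))"
| "wf_prog d (While qs B S) = (binary_on d qs B \<and> wf_prog d S)"
| "wf_prog d (Hole F) = True"

fun sem :: "'v prog \<Rightarrow> ('v \<Rightarrow> nat) \<Rightarrow> 'v op \<Rightarrow> 'v op" where
  "sem Skip d \<rho> = \<rho>"
| "sem (Init qs) d \<rho> = init_op d qs \<rho>"
| "sem (Unit qs U) d \<rho> = unit_op d qs U \<rho>"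
| "sem (Seq S1 S2) d \<rho> = sem S2 d (sem S1 d \<rho>)"
| "sem (Repeat N S) d \<rho> = ((\<lambda>X. sem S d X) ^^ N) \<rho>"
| "sem (Case qs cs) d \<rho> = sumlistop (map (\<lambda>c. sem (snd c) d (meas_op d qs (fst c) \<rho>)) cs)"
| "sem (While qs B S) d \<rho> =
     (\<lambda>i j. \<Sum>k. ((B0 d qs B \<circ> ((\<lambda>X. sem S d X) \<circ> B1 d qs B) ^^ k) \<rho>) i j)"
| "sem (Hole F) d \<rho> = zeroop"

definition valid_par :: "('v \<Rightarrow> nat) \<Rightarrow> 'v op \<Rightarrow> 'v prog \<Rightarrow> 'v op \<Rightarrow> bool" where
  "valid_par d P S Q \<longleftrightarrow> (\<forall>\<rho>. partial_state d \<rho> \<longrightarrow>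
     Re (trace d (mul d P \<rho>)) \<le> Re (trace d (mul d Q (sem S d \<rho>))) + Re (trace d \<rho>) - Re (trace d (sem S d \<rho>)))"

text \<open>Single-specification instances of the basic rules: hole_inst d (P,Q) T
  means that a basic rule rewrites the hole {P}[]{Q} to T.\<close>
inductive hole_inst :: "('v \<Rightarrow> nat) \<Rightarrow> 'v op \<times> 'v op \<Rightarrow> 'v prog \<Rightarrow> bool" for d where
  H_skip: "loewner d P Q \<Longrightarrow> hole_inst d (P, Q) Skip"
| H_init: "loewner d P (init_pre d qs Q) \<Longrightarrow> hole_inst d (P, Q) (Init qs)"
| H_unit: "unitary_on d qs U \<Longrightarrow> loewner d P (mul d (mul d (adj (lift qs U)) Q) (lift qs U))
           \<Longrightarrow> hole_inst d (P, Q) (Unit qs U)"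
| H_seq: "is_pred d R \<Longrightarrow> hole_inst d (P, Q) (Seq (Hole {(P, R)}) (Hole {(R, Q)}))"
| HP_split: "finite (\<Gamma> :: nat set) \<Longrightarrow> (\<forall>g\<in>\<Gamma>. 0 \<le> p g) \<Longrightarrow> (\<Sum>g\<in>\<Gamma>. p g) = 1 \<Longrightarrow>
           (\<forall>g\<in>\<Gamma>. is_pred d (Pg g) \<and> is_pred d (Qg g)) \<Longrightarrow>
           loewner d P (sumop \<Gamma> (\<lambda>g. scaleop (p g) (Pg g))) \<Longrightarrow>
           loewner d (sumop \<Gamma> (\<lambda>g. scaleop (p g) (Qg g))) Q \<Longrightarrow>
           hole_inst d (P, Q) (Hole {(Pg g, Qg g) | g. g \<in> \<Gamma>})"
| H_repeat: "(\<forall>j\<le>N. is_pred d (R j)) \<Longrightarrow> loewner d P (R 0) \<Longrightarrow> loewner d (R N) Q \<Longrightarrow>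
           hole_inst d (P, Q) (Repeat N (Hole {(R j, R (Suc j)) | j. j < N}))"
| H_case: "measurement_on d qs Ms \<Longrightarrow> length Ps = length Ms \<Longrightarrow> (\<forall>P'\<in>set Ps. is_pred d P') \<Longrightarrow>
           loewner d P (sumlistop (map2 (\<lambda>M P'. meas_op d qs M P') Ms Ps)) \<Longrightarrow>
           hole_inst d (P, Q) (Case qs (map2 (\<lambda>M P'. (M, Hole {(P', Q)})) Ms Ps))"
| HP_while: "binary_on d qs B \<Longrightarrow> is_pred d R \<Longrightarrow>
           loewner d P (addop (B0 d qs B Q) (B1 d qs B R)) \<Longrightarrow>
           hole_inst d (P, Q) (While qs B (Hole {(R, addop (B0 d qs B Q) (B1 d qs B R))}))"

fun shape :: "'v prog \<Rightarrow> 'v prog" where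
  "shape Skip = Skip"
| "shape (Init qs) = Init qs"
| "shape (Unit qs U) = Unit qs U"
| "shape (Seq S1 S2) = Seq (shape S1) (shape S2)"
| "shape (Repeat N S) = Repeat N (shape S)"
| "shape (Case qs cs) = Case qs (map (\<lambda>c. (fst c, shape (snd c))) cs)"
| "shape (While qs B S) = While qs B (shape S)"
| "shape (Hole F) = Hole {}"

fun holes :: "'v prog \<Rightarrow> ('v op \<times> 'v op) set list" where
  "holes Skip = []"
| "holes (Init qs) = []"
| "holes (Unit qs U) = []"
| "holes (Seq S1 S2) = holes S1 @ holes S2"
| "holes (Repeat N S) = holes S"
| "holes (Case qs cs) = concat (map (\<lambda>c. holes (snd c)) cs)"
| "holes (While qs B S) = holes S"
| "holes (Hole F) = [F]"

fun rule_shape :: "'v prog \<Rightarrow> bool" where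
  "rule_shape Skip = True"
| "rule_shape (Init qs) = True"
| "rule_shape (Unit qs U) = True"
| "rule_shape (Seq S1 S2) = ((\<exists>F. S1 = Hole F) \<and> (\<exists>F. S2 = Hole F))"
| "rule_shape (Repeat N S) = (\<exists>F. S = Hole F)"
| "rule_shape (Case qs cs) = (\<forall>c\<in>set cs. \<exists>F. snd c = Hole F)"
| "rule_shape (While qs B S) = (\<exists>F. S = Hole F)"
| "rule_shape (Hole F) = True"

text \<open>A basic rule applied to a hole carrying the family F of specifications:
  for every specification in F (possibly several times, mimicking repeated
  indices) a rule instance is chosen, all with the same syntactic program;
  the holes of the result carry the union of the corresponding families.\<close>
definition hole_step :: "('v \<Rightarrow> nat) \<Rightarrow> ('v op \<times> 'v op) set \<Rightarrow> 'v prog \<Rightarrow> bool" where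
  "hole_step d F T \<longleftrightarrow> rule_shape T \<and> wf_prog d T \<and>
     (\<exists>I :: (('v op \<times> 'v op) \<times> 'v prog) set.
        (\<forall>(s, t)\<in>I. s \<in> F \<and> hole_inst d s t \<and> shape t = shape T) \<and>
        (\<forall>s\<in>F. \<exists>t. (s, t) \<in> I) \<and>
        (\<forall>k < length (holes T). holes T ! k = (\<Union>(s, t)\<in>I. holes t ! k)))"

inductive refine_par :: "('v \<Rightarrow> nat) \<Rightarrow> 'v prog \<Rightarrow> 'v prog \<Rightarrow> bool" for d where
  hole: "hole_step d F T \<Longrightarrow> refine_par d (Hole F) T"
| seqL: "refine_par d S S' \<Longrightarrow> refine_par d (Seq S R) (Seq S' R)"
| seqR: "refine_par d R R' \<Longrightarrow> refine_par d (Seq S R) (Seq S R')"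
| repeat: "refine_par d S S' \<Longrightarrow> refine_par d (Repeat N S) (Repeat N S')"
| case_: "refine_par d S S' \<Longrightarrow>
           refine_par d (Case qs (cs1 @ (M, S) # cs2)) (Case qs (cs1 @ (M, S') # cs2))"
| while: "refine_par d S S' \<Longrightarrow> refine_par d (While qs B S) (While qs B S')"

end

theory Submission
  imports Defs "HOL-Library.Complex_Order" "HOL-Computational_Algebra.Formal_Power_Series"
begin

text \<open>
  The semantics of a concrete program is a linear, positive, trace-nonincreasing map \<open>\<Phi>\<close>.
  Hence \<open>\<rho> \<mapsto> tr (Q \<Phi>(\<rho>)) + tr \<rho> - tr \<Phi>(\<rho>)\<close> is a linear functional with values between \<open>0\<close> and
  \<open>tr \<rho>\<close>, so it equals \<open>\<rho> \<mapsto> tr (W \<rho>)\<close> for a predicate \<open>W\<close>, the weakest liberal precondition of \<open>Q\<close>,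
  and validity of a triple with precondition \<open>P\<close> says that \<open>P\<close> is below \<open>W\<close>. Weakest liberal
  preconditions supply the intermediate predicates of every rule; the induction on programs is
  carried out for arbitrary families of valid specifications at once, because the repeat rule
  produces such families.

  The measurement maps need the positive square root to exist and to be unique. Existence comes
  from the binomial series of \<open>sqrt (1 - T)\<close> for \<open>0 \<le> T \<le> 1\<close>. For uniqueness, if
  \<open>R\<close> and \<open>R'\<close> have the same square and \<open>D = R - R'\<close>, then \<open>D(R + R')D\<close> has trace \<open>0\<close>, so
  \<open>D R D = D R' D = 0\<close>, hence \<open>D\<^sup>3 = 0\<close> and \<open>D = 0\<close>.
\<close>

subsection \<open>Quadratic forms and positive semidefinite operators\<close>

definition qform :: "'v mem set \<Rightarrow> 'v op \<Rightarrow> ('v mem \<Rightarrow> complex) \<Rightarrow> complex" where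
  "qform X A v = (\<Sum>i\<in>X. \<Sum>j\<in>X. cnj (v i) * A i j * v j)"

text \<open>The order of \<open>Complex_Order\<close> compares real parts and requires equal
  imaginary parts, so \<open>0 \<le> z\<close> packs both conjuncts of \<open>psdB_def\<close> into
  one inequality.\<close>

lemma psdB_iff_qform: "psdB X A \<longleftrightarrow> (\<forall>v. 0 \<le> qform X A v)"
  by (auto simp: psdB_def qform_def less_eq_complex_def)

lemma psdBI: "(\<And>v. 0 \<le> qform X A v) \<Longrightarrow> psdB X A"
  by (simp add: psdB_iff_qform)

lemma psdBD: "psdB X A \<Longrightarrow> 0 \<le> qform X A v"
  by (simp add: psdB_iff_qform)

lemma eq_onI: "(\<And>i j. i \<in> X \<Longrightarrow> j \<in> X \<Longrightarrow> A i j = B i j) \<Longrightarrow> eq_on X A B"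
  by (simp add: eq_on_def)

lemma eq_onD: "eq_on X A B \<Longrightarrow> i \<in> X \<Longrightarrow> j \<in> X \<Longrightarrow> A i j = B i j"
  by (simp add: eq_on_def)

lemma eq_on_refl [simp]: "eq_on X A A"
  by (simp add: eq_on_def)

lemma eq_on_sym: "eq_on X A B \<Longrightarrow> eq_on X B A"
  by (simp add: eq_on_def)

lemma eq_on_trans [trans]: "eq_on X A B \<Longrightarrow> eq_on X B C \<Longrightarrow> eq_on X A C"
  by (simp add: eq_on_def)

lemma qform_cong: "eq_on X A B \<Longrightarrow> qform X A v = qform X B v"
  unfolding qform_def by (intro sum.cong refl) (simp add: eq_on_def)

lemma psdB_cong: "eq_on X A B \<Longrightarrow> psdB X A \<longleftrightarrow> psdB X B"
  using qform_cong psdB_iff_qform by metis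

lemma mulB_cong: "eq_on X A A' \<Longrightarrow> eq_on X B B' \<Longrightarrow> eq_on X (mulB X A B) (mulB X A' B')"
  by (simp add: eq_on_def mulB_def)

lemma trace_cong: "eq_on (fullb d) A B \<Longrightarrow> trace d A = trace d B"
  by (simp add: eq_on_def trace_def)

lemma mulB_assoc: "mulB X (mulB X A B) C = mulB X A (mulB X B C)"
proof (intro ext)
  fix i j
  have "mulB X (mulB X A B) C i j = (\<Sum>k\<in>X. \<Sum>l\<in>X. A i l * B l k * C k j)"
    by (simp add: mulB_def sum_distrib_right)
  also have "\<dots> = (\<Sum>l\<in>X. \<Sum>k\<in>X. A i l * B l k * C k j)"
    by (rule sum.swap)
  also have "\<dots> = mulB X A (mulB X B C) i j"
    by (simp add: mulB_def sum_distrib_left mult.assoc)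
  finally show "mulB X (mulB X A B) C i j = mulB X A (mulB X B C) i j" .
qed

lemma mulB_idop_left: "finite X \<Longrightarrow> i \<in> X \<Longrightarrow> mulB X idop A i j = A i j"
  by (simp add: mulB_def idop_def if_distrib[of "\<lambda>x. x * _"] cong: if_cong)

lemma mulB_idop_right: "finite X \<Longrightarrow> j \<in> X \<Longrightarrow> mulB X A idop i j = A i j"
  by (simp add: mulB_def idop_def if_distrib[of "\<lambda>x. _ * x"] cong: if_cong)

lemma mulB_addop_left: "mulB X (addop A B) C = addop (mulB X A C) (mulB X B C)"
  by (simp add: mulB_def addop_def distrib_right sum.distrib fun_eq_iff)

lemma mulB_addop_right: "mulB X C (addop A B) = addop (mulB X C A) (mulB X C B)"
  by (simp add: mulB_def addop_def distrib_left sum.distrib fun_eq_iff)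

lemma mulB_subop_left: "mulB X (subop A B) C = subop (mulB X A C) (mulB X B C)"
  by (simp add: mulB_def subop_def left_diff_distrib sum_subtractf fun_eq_iff)

lemma mulB_subop_right: "mulB X C (subop A B) = subop (mulB X C A) (mulB X C B)"
  by (simp add: mulB_def subop_def right_diff_distrib sum_subtractf fun_eq_iff)

lemma mulB_scaleop_left: "mulB X (scaleop c A) B = scaleop c (mulB X A B)"
  by (simp add: mulB_def scaleop_def sum_distrib_left fun_eq_iff mult_ac)

lemma mulB_scaleop_right: "mulB X A (scaleop c B) = scaleop c (mulB X A B)"
  by (simp add: mulB_def scaleop_def sum_distrib_left fun_eq_iff mult_ac)

lemma adj_mulB: "adj (mulB X A B) = mulB X (adj B) (adj A)"
  by (simp add: mulB_def adj_def fun_eq_iff mult.commute)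

lemma trace_addop: "trace d (addop A B) = trace d A + trace d B"
  by (simp add: trace_def addop_def sum.distrib)

lemma trace_subop: "trace d (subop A B) = trace d A - trace d B"
  by (simp add: trace_def subop_def sum_subtractf)

lemma trace_scaleop: "trace d (scaleop c A) = c * trace d A"
  by (simp add: trace_def scaleop_def sum_distrib_left)

lemma trace_mul_commute: "trace d (mul d A B) = trace d (mul d B A)"
  unfolding trace_def mulB_def by (subst sum.swap) (simp add: mult.commute)

lemma qform_addop: "qform X (addop A B) v = qform X A v + qform X B v"
  by (simp add: qform_def addop_def algebra_simps sum.distrib)

lemma qform_subop: "qform X (subop A B) v = qform X A v - qform X B v"
  by (simp add: qform_def subop_def algebra_simps sum_subtractf)

lemma qform_scaleop: "qform X (scaleop c A) v = complex_of_real c * qform X A v"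
  by (simp add: qform_def scaleop_def sum_distrib_left mult_ac)

lemma qform_sumop: "qform X (sumop Y f) v = (\<Sum>y\<in>Y. qform X (f y) v)"
proof -
  have "qform X (sumop Y f) v = (\<Sum>i\<in>X. \<Sum>j\<in>X. \<Sum>y\<in>Y. cnj (v i) * f y i j * v j)"
    by (simp add: qform_def sumop_def sum_distrib_left sum_distrib_right)
  also have "\<dots> = (\<Sum>y\<in>Y. qform X (f y) v)"
    unfolding qform_def sum.cartesian_product
    by (rule sum.reindex_bij_witness[of _ "\<lambda>(y,i,j). (i,j,y)" "\<lambda>(i,j,y). (y,i,j)"]) auto
  finally show ?thesis .
qed

lemma qform_idop: "finite X \<Longrightarrow> qform X idop v = (\<Sum>i\<in>X. complex_of_real ((cmod (v i))\<^sup>2))"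
  unfolding qform_def idop_def
  by (simp add: if_distrib[of "\<lambda>x. _ * x"] if_distrib[of "\<lambda>x. x * _"] complex_norm_square[symmetric] mult.commute cong: if_cong)

lemma of_real_nonneg_complex: "0 \<le> r \<Longrightarrow> 0 \<le> complex_of_real r"
  by (simp add: less_eq_complex_def)

lemma psdB_zeroop: "psdB X zeroop"
  by (rule psdBI) (simp add: qform_def zeroop_def)

lemma psdB_idop: "finite X \<Longrightarrow> psdB X idop"
  by (rule psdBI) (simp add: qform_idop of_real_nonneg_complex sum_nonneg flip: of_real_power of_real_sum)

lemma psdB_addop: "psdB X A \<Longrightarrow> psdB X B \<Longrightarrow> psdB X (addop A B)"
  by (simp add: psdB_iff_qform qform_addop)

lemma psdB_scaleop: "0 \<le> c \<Longrightarrow> psdB X A \<Longrightarrow> psdB X (scaleop c A)"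
  by (simp add: psdB_iff_qform qform_scaleop of_real_nonneg_complex)

lemma psdB_sumop: "(\<And>y. y \<in> Y \<Longrightarrow> psdB X (f y)) \<Longrightarrow> psdB X (sumop Y f)"
  by (simp add: psdB_iff_qform qform_sumop sum_nonneg)

lemma psdB_sumlistop: "(\<And>A. A \<in> set As \<Longrightarrow> psdB X A) \<Longrightarrow> psdB X (sumlistop As)"
  by (induction As) (auto simp: sumlistop_def psdB_zeroop intro!: psdB_addop)

text \<open>The vector on the right is \<open>adj K\<close> applied to \<open>v\<close>; the rest is
  reordering a fourfold sum. Conjugation therefore preserves positivity.\<close>

lemma qform_conjugate:
  "qform X (mulB X (mulB X K A) (adj K)) v = qform X A (\<lambda>a. \<Sum>i\<in>X. cnj (K i a) * v i)"
proof -
  have "qform X (mulB X (mulB X K A) (adj K)) v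
      = (\<Sum>i\<in>X. \<Sum>j\<in>X. \<Sum>b\<in>X. \<Sum>a\<in>X. cnj (v i) * K i a * A a b * (cnj (K j b) * v j))"
    by (simp add: qform_def mulB_def adj_def sum_distrib_left sum_distrib_right mult_ac)
  also have "\<dots> = (\<Sum>b\<in>X. \<Sum>a\<in>X. \<Sum>i\<in>X. \<Sum>j\<in>X. cnj (v i) * K i a * A a b * (cnj (K j b) * v j))"
    unfolding sum.cartesian_product
    by (rule sum.reindex_bij_witness[of _ "\<lambda>(b,a,i,j). (i,j,b,a)" "\<lambda>(i,j,b,a). (b,a,i,j)"]) auto
  also have "\<dots> = (\<Sum>a\<in>X. \<Sum>b\<in>X. \<Sum>i\<in>X. \<Sum>j\<in>X. cnj (v i) * K i a * A a b * (cnj (K j b) * v j))"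
    by (rule sum.swap)
  also have "\<dots> = qform X A (\<lambda>a. \<Sum>i\<in>X. cnj (K i a) * v i)"
    by (simp add: qform_def sum_distrib_left sum_distrib_right mult_ac)
  finally show ?thesis .
qed

lemma psdB_conjugate: "psdB X A \<Longrightarrow> psdB X (mulB X (mulB X K A) (adj K))"
  by (simp add: psdB_iff_qform qform_conjugate)

text \<open>Vectors supported on two basis states expose the off-diagonal entries; hermiticity and
  the entry bound both come from suitable choices of \<open>a\<close> and \<open>b\<close>.\<close>

lemma qform_two_point:
  assumes "finite X" "i \<in> X" "j \<in> X" "i \<noteq> j"
  shows "qform X A (\<lambda>k. if k = i then a else if k = j then b else 0) =
    cnj a * A i i * a + cnj a * A i j * b + cnj b * A j i * a + cnj b * A j j * b"
proof -
  let ?v = "\<lambda>k. if k = i then a else if k = j then b else 0"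
  have inner: "(\<Sum>l\<in>X. cnj (?v k) * A k l * ?v l) = cnj (?v k) * A k i * a + cnj (?v k) * A k j * b" for k
  proof -
    have "(\<Sum>l\<in>X. cnj (?v k) * A k l * ?v l) = (\<Sum>l\<in>{i,j}. cnj (?v k) * A k l * ?v l)"
      using assms by (intro sum.mono_neutral_right) auto
    then show ?thesis using assms by auto
  qed
  have "qform X A ?v = (\<Sum>k\<in>X. cnj (?v k) * A k i * a + cnj (?v k) * A k j * b)"
    unfolding qform_def inner ..
  also have "\<dots> = (\<Sum>k\<in>{i,j}. cnj (?v k) * A k i * a + cnj (?v k) * A k j * b)"
    using assms by (intro sum.mono_neutral_right) auto
  also have "\<dots> = cnj a * A i i * a + cnj a * A i j * b + cnj b * A j i * a + cnj b * A j j * b"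
    using assms by auto
  finally show ?thesis .
qed

lemma qform_one_point:
  assumes "finite X" "i \<in> X"
  shows "qform X A (\<lambda>k. if k = i then 1 else 0) = A i i"
  using assms unfolding qform_def
  by (simp add: if_distrib[of "\<lambda>x. _ * x"] if_distrib[of "\<lambda>x. x * _"] if_distrib[of cnj] cong: if_cong)

lemma psdB_diag:
  assumes "finite X" "psdB X A" "i \<in> X"
  shows "0 \<le> A i i"
  using psdBD[OF assms(2)] qform_one_point[OF assms(1,3)] by metis

text \<open>Off the diagonal, the form is real at the vectors \<open>(1, 1)\<close> and
  \<open>(1, \<i>)\<close>: the first makes the imaginary parts of \<open>A i j\<close> and
  \<open>A j i\<close> cancel, the second makes their real parts agree.\<close>

lemma psdB_hermitian:
  assumes "finite X" "psdB X A" "i \<in> X" "j \<in> X"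
  shows "cnj (A j i) = A i j"
proof (cases "i = j")
  case True
  then show ?thesis using psdB_diag[OF assms(1-3)] by (simp add: less_eq_complex_def complex_eq_iff)
next
  case False
  have d: "Im (A i i) = 0" "Im (A j j) = 0"
    using psdB_diag[OF assms(1,2)] assms(3,4) by (auto simp: less_eq_complex_def)
  have "0 \<le> qform X A (\<lambda>k. if k = i then 1 else if k = j then 1 else 0)"
       "0 \<le> qform X A (\<lambda>k. if k = i then 1 else if k = j then \<i> else 0)"
    by (rule psdBD[OF assms(2)])+
  then show ?thesis
    unfolding qform_two_point[OF assms(1,3,4) False] using d
    by (simp add: less_eq_complex_def complex_eq_iff)
qed

lemma psdB_entry_bound:
  assumes "finite X" "psdB X A" "i \<in> X" "j \<in> X"
  shows "2 * cmod (A i j) \<le> Re (A i i) + Re (A j j)"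
proof (cases "i = j \<or> A i j = 0")
  case True
  have "0 \<le> A i i" "0 \<le> A j j" using psdB_diag[OF assms(1,2)] assms by auto
  then show ?thesis using True by (auto simp: less_eq_complex_def cmod_def)
next
  case False
  define z where "z = A i j"
  \<comment> \<open>This unit phase turns both cross terms of the form at \<open>(1, b)\<close> into
    \<open>- cmod z\<close>, so nonnegativity of the form becomes the bound.\<close>
  define b where "b = - cnj z / cmod z"
  have z0: "cmod z \<noteq> 0" using False z_def by auto
  have ji: "A j i = cnj z" using psdB_hermitian[OF assms(1,2,4,3)] by (simp add: z_def)
  have zz: "z * cnj z = complex_of_real (cmod z) * complex_of_real (cmod z)"
    by (metis complex_norm_square power2_eq_square of_real_mult)
  have zb: "z * b = - cmod z" "cnj b * cnj z = - cmod z" "cnj b * b = 1"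
    using z0 zz by (simp_all add: b_def field_simps)
  have "0 \<le> qform X A (\<lambda>k. if k = i then 1 else if k = j then b else 0)"
    by (rule psdBD[OF assms(2)])
  also have "\<dots> = A i i + z * b + cnj b * cnj z + cnj b * b * A j j"
    using False by (simp add: qform_two_point[OF assms(1,3,4)] z_def[symmetric] ji)
  also have "\<dots> = A i i - 2 * cmod z + A j j" by (simp add: zb)
  finally show ?thesis by (simp add: less_eq_complex_def z_def)
qed

lemma psdB_adj: "finite X \<Longrightarrow> psdB X A \<Longrightarrow> eq_on X (adj A) A"
  by (rule eq_onI) (simp add: adj_def psdB_hermitian)

lemma psdB_conjugate_hermitian:
  assumes "eq_on X (adj K) K" "psdB X A"
  shows "psdB X (mulB X (mulB X K A) K)"
  using psdB_conjugate[OF assms(2), of K] psdB_cong[OF mulB_cong[OF eq_on_refl assms(1)]] by blast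

subsection \<open>Square roots\<close>

text \<open>The coefficient of \<open>x ^ k\<close> in the binomial series of
  \<open>sqrt (1 - x)\<close>.\<close>

definition sqrt_coeff :: "nat \<Rightarrow> real" where
  "sqrt_coeff k = ((1/2) gchoose k) * (-1) ^ k"

lemma sqrt_coeff_0 [simp]: "sqrt_coeff 0 = 1"
  by (simp add: sqrt_coeff_def)

lemma neg_half_gchoose_nonneg: "0 \<le> (-1) ^ m * ((-1/2 :: real) gchoose m)"
proof -
  have "(-1) ^ m * ((-1/2 :: real) gchoose m) = pochhammer (1/2) m / fact m"
    by (simp add: gbinomial_pochhammer flip: mult.assoc power_mult_distrib)
  then show ?thesis by (simp add: pochhammer_nonneg)
qed

text \<open>Dividing a power series by \<open>1 - x\<close> sums its coefficients, so these partial
  sums are the coefficients of \<open>(1 - x) powr (-1/2)\<close>, all of which are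
  nonnegative.\<close>

lemma sum_sqrt_coeff_nonneg: "0 \<le> (\<Sum>k\<le>m. sqrt_coeff k)"
  using gbinomial_sum_lower_neg[of "1/2 :: real" m] neg_half_gchoose_nonneg[of m]
  by (simp add: sqrt_coeff_def)

lemma sqrt_coeff_Suc_nonpos: "sqrt_coeff (Suc k) \<le> 0"
proof -
  have "(1/2 :: real) gchoose Suc k = (1/2) / real (Suc k) * ((-1/2) gchoose k)"
    using gbinomial_factors[of "-1/2 :: real" k] by (simp add: gbinomial_mult_1 field_simps)
  then have "sqrt_coeff (Suc k) = - ((1/2) / real (Suc k)) * ((-1) ^ k * ((-1/2) gchoose k))"
    by (simp add: sqrt_coeff_def)
  also have "\<dots> \<le> 0"
    using neg_half_gchoose_nonneg[of k] by (intro mult_nonpos_nonneg) auto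
  finally show ?thesis .
qed

text \<open>Only the coefficient of index \<open>0\<close>, which is \<open>1\<close>, is positive.
  Taking absolute values thus replaces a partial sum \<open>s\<close> by \<open>2 - s\<close>, and
  \<open>s\<close> is nonnegative.\<close>

lemma sum_abs_sqrt_coeff_le: "(\<Sum>k\<le>m. \<bar>sqrt_coeff k\<bar>) \<le> 2"
proof -
  have "(\<Sum>k\<le>m. \<bar>sqrt_coeff k\<bar>) = 2 - (\<Sum>k\<le>m. sqrt_coeff k)"
    using sqrt_coeff_Suc_nonpos by (induction m) (auto simp: abs_of_nonpos)
  then show ?thesis using sum_sqrt_coeff_nonneg[of m] by simp
qed

lemma summable_abs_sqrt_coeff: "summable (\<lambda>k. \<bar>sqrt_coeff k\<bar>)"
proof (rule bounded_imp_summable)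
  show "(\<Sum>k\<le>m. \<bar>sqrt_coeff k\<bar>) \<le> 2" for m by (rule sum_abs_sqrt_coeff_le)
qed simp

text \<open>The square of \<open>sqrt (1 - x)\<close> is the polynomial \<open>1 - x\<close>; on
  coefficients this is the Vandermonde identity for \<open>1/2 + 1/2 = 1\<close>.\<close>

lemma sqrt_coeff_convolution:
  "(\<Sum>k\<le>n. sqrt_coeff k * sqrt_coeff (n - k)) = (if n = 0 then 1 else if n = 1 then -1 else 0)"
proof -
  have "(\<Sum>k\<le>n. sqrt_coeff k * sqrt_coeff (n - k))
      = (\<Sum>k\<le>n. (-1) ^ n * (((1/2) gchoose k) * ((1/2) gchoose (n - k))))"
    by (intro sum.cong refl) (simp add: sqrt_coeff_def mult_ac flip: power_add)
  also have "\<dots> = (-1) ^ n * (1 gchoose n)"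
    using gbinomial_Vandermonde[of "1/2 :: real" "1/2" n] by (simp add: sum_distrib_left[symmetric] atLeast0AtMost)
  also have "(1 :: real) gchoose n = real (1 choose n)"
    using binomial_gbinomial[of 1 n, where 'a = real] by simp
  also have "(-1) ^ n * real (1 choose n) = (if n = 0 then 1 else if n = 1 then -1 else 0)"
    by (cases n; cases "n - 1") auto
  finally show ?thesis .
qed

section \<open>Powers of a positive contraction and the square-root series\<close>

fun opow :: "'v mem set \<Rightarrow> 'v op \<Rightarrow> nat \<Rightarrow> 'v op" where
  "opow X T 0 = idop"
| "opow X T (Suc k) = mulB X T (opow X T k)"

lemma opow_add:
  assumes "finite X"
  shows "eq_on X (mulB X (opow X T a) (opow X T b)) (opow X T (a + b))"
proof (induction a)
  case 0
  then show ?case using assms by (simp add: eq_on_def mulB_idop_left)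
next
  case (Suc a)
  then show ?case using mulB_cong[OF eq_on_refl Suc, of T] by (simp add: mulB_assoc)
qed

lemma opow_commute:
  assumes "finite X"
  shows "eq_on X (mulB X (opow X T k) T) (opow X T (Suc k))"
proof -
  have "eq_on X T (opow X T 1)" using assms by (simp add: eq_on_def mulB_idop_right)
  then have "eq_on X (mulB X (opow X T k) T) (mulB X (opow X T k) (opow X T 1))"
    by (intro mulB_cong) auto
  also have "eq_on X \<dots> (opow X T (k + 1))" by (rule opow_add[OF assms])
  finally show ?thesis by simp
qed

text \<open>Conjugation by \<open>T\<close> raises the exponent by two, so positivity passes from
  \<open>k\<close> to \<open>k + 2\<close> and two starting cases suffice. The upper bound
  telescopes over the differences \<open>E k\<close> of consecutive powers, which are positive by
  the same two-step argument. Square roots are avoided here because their construction rests on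
  these bounds.\<close>

lemma opow_contraction:
  assumes X: "finite X" and T: "psdB X T" "psdB X (subop idop T)"
  shows "psdB X (opow X T k)" "psdB X (subop idop (opow X T k))"
proof -
  have T_adj: "eq_on X (adj T) T" by (rule psdB_adj[OF X T(1)])
  have iT_adj: "eq_on X (adj (subop idop T)) (subop idop T)" by (rule psdB_adj[OF X T(2)])
  have step: "eq_on X (mulB X (mulB X T (opow X T k)) T) (opow X T (Suc (Suc k)))" for k
    using opow_commute[OF X, of T "Suc k"] by simp
  have idm: "eq_on X (mulB X T idop) T" "eq_on X (mulB X idop T) T"
    using X by (simp_all add: eq_on_def mulB_idop_left mulB_idop_right)
  have pow: "psdB X (opow X T k) \<and> psdB X (opow X T (Suc k))" for k
  proof (induction k)
    case 0
    then show ?case using T psdB_idop[OF X] psdB_cong[OF idm(1)] by simp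
  next
    case (Suc k)
    then show ?case
      using psdB_conjugate_hermitian[OF T_adj, of "opow X T k"] psdB_cong[OF step] by blast
  qed
  then show "psdB X (opow X T k)" by blast
  define E where "E = (\<lambda>k. subop (opow X T k) (opow X T (Suc k)))"
  have E: "psdB X (E k) \<and> psdB X (E (Suc k))" for k
  proof (induction k)
    case 0
    have "eq_on X (subop idop T) (E 0)"
      using idm(1) by (simp add: E_def eq_on_def subop_def)
    then have E0: "psdB X (E 0)" using T(2) psdB_cong by blast
    let ?N = "subop idop T"
    \<comment> \<open>The identity \<open>T - T\<^sup>2 = T (I - T) T + (I - T) T (I - T)\<close>
      exhibits \<open>E 1\<close> as a sum of conjugates of positive operators.\<close>
    have "eq_on X (addop (mulB X (mulB X T ?N) T) (mulB X (mulB X ?N T) ?N)) (E 1)"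
    proof (rule eq_onI)
      fix i j assume ij: "i \<in> X" "j \<in> X"
      have TT: "mulB X (mulB X T idop) T i j = mulB X T T i j" "mulB X (mulB X idop T) T i j = mulB X T T i j"
        using mulB_cong[OF idm(1) eq_on_refl] mulB_cong[OF idm(2) eq_on_refl] ij by (auto simp: eq_on_def)
      have "addop (mulB X (mulB X T ?N) T) (mulB X (mulB X ?N T) ?N) i j = mulB X idop T i j - mulB X T T i j"
        using X ij by (simp add: mulB_subop_left mulB_subop_right)
          (simp add: addop_def subop_def mulB_idop_left mulB_idop_right TT)
      then show "addop (mulB X (mulB X T ?N) T) (mulB X (mulB X ?N T) ?N) i j = E 1 i j"
        using X ij by (simp add: E_def subop_def mulB_idop_left mulB_idop_right flip: mulB_assoc)
    qed
    moreover have "psdB X (addop (mulB X (mulB X T ?N) T) (mulB X (mulB X ?N T) ?N))"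
      by (intro psdB_addop psdB_conjugate_hermitian T T_adj iT_adj)
    ultimately have "psdB X (E 1)" using psdB_cong by blast
    with E0 show ?case by simp
  next
    case (Suc k)
    have "eq_on X (mulB X (mulB X T (E k)) T) (E (Suc (Suc k)))"
      unfolding E_def using step[of k] step[of "Suc k"]
      unfolding mulB_subop_left mulB_subop_right by (simp add: eq_on_def subop_def)
    then show ?case
      using Suc psdB_conjugate_hermitian[OF T_adj, of "E k"] psdB_cong by blast
  qed
  show "psdB X (subop idop (opow X T k))"
  proof (induction k)
    case 0
    show ?case by (rule psdBI) (simp add: qform_subop)
  next
    case (Suc k)
    have "subop idop (opow X T (Suc k)) = addop (subop idop (opow X T k)) (E k)"
      by (simp add: E_def subop_def addop_def)
    then show ?case using Suc E psdB_addop by metis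
  qed
qed

text \<open>Applied to the powers of \<open>T\<close>, this lets the absolutely summable
  \<open>sqrt_coeff\<close> dominate every entry of the series below.\<close>

lemma contraction_entry_le_1:
  assumes X: "finite X" and T: "psdB X T" "psdB X (subop idop T)" and ij: "i \<in> X" "j \<in> X"
  shows "cmod (T i j) \<le> 1"
proof -
  have "Re (T k k) \<le> 1" if "k \<in> X" for k
    using psdB_diag[OF X T(2) that] by (simp add: subop_def idop_def less_eq_complex_def)
  from this[OF ij(1)] this[OF ij(2)] show ?thesis using psdB_entry_bound[OF X T(1) ij] by linarith
qed

definition sqrt_series :: "'v mem set \<Rightarrow> 'v op \<Rightarrow> 'v op" where
  "sqrt_series X T i j = (\<Sum>k. complex_of_real (sqrt_coeff k) * opow X T k i j)"

lemma sqrt_series_props: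
  assumes X: "finite X" and T: "psdB X T" "psdB X (subop idop T)"
  shows "psdB X (sqrt_series X T)"
    and "eq_on X (mulB X (sqrt_series X T) (sqrt_series X T)) (subop idop T)"
proof -
  have nsum: "summable (\<lambda>k. norm (complex_of_real (sqrt_coeff k) * opow X T k i j))"
    if "i \<in> X" "j \<in> X" for i j
  proof (rule summable_comparison_test'[OF summable_abs_sqrt_coeff])
    fix n :: nat
    show "norm (norm (complex_of_real (sqrt_coeff n) * opow X T n i j)) \<le> \<bar>sqrt_coeff n\<bar>"
      using contraction_entry_le_1[OF X opow_contraction[OF X T] that]
      by (simp add: norm_mult mult_left_le)
  qed
  have sums: "(\<lambda>k. complex_of_real (sqrt_coeff k) * opow X T k i j) sums sqrt_series X T i j"
    if "i \<in> X" "j \<in> X" for i j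
    unfolding sqrt_series_def using summable_norm_cancel[OF nsum[OF that]] by (rule summable_sums)
  show "psdB X (sqrt_series X T)"
  proof (rule psdBI)
    fix v
    have "(\<lambda>k. complex_of_real (sqrt_coeff k) * qform X (opow X T k) v) sums qform X (sqrt_series X T) v"
    proof -
      have "(\<lambda>k. \<Sum>i\<in>X. \<Sum>j\<in>X. cnj (v i) * (complex_of_real (sqrt_coeff k) * opow X T k i j) * v j)
          sums qform X (sqrt_series X T) v"
        unfolding qform_def by (intro sums_sum sums_mult sums_mult2 sums)
      then show ?thesis by (simp add: qform_def sum_distrib_left mult_ac)
    qed
    then have lim: "(\<lambda>m. \<Sum>k\<le>m. complex_of_real (sqrt_coeff k) * qform X (opow X T k) v)
        \<longlonglongrightarrow> qform X (sqrt_series X T) v"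
      by (simp add: sums_def_le)
    \<comment> \<open>All coefficients after the first are nonpositive, and the form of each power
      is at most that of \<open>idop\<close>. Replacing every power by \<open>idop\<close> can only
      lower the partial sum, and leaves a nonnegative multiple of the form of
      \<open>idop\<close>.\<close>
    have pos: "0 \<le> (\<Sum>k\<le>m. complex_of_real (sqrt_coeff k) * qform X (opow X T k) v)" for m
    proof -
      have "0 \<le> complex_of_real (\<Sum>k\<le>m. sqrt_coeff k) * qform X idop v"
        using of_real_nonneg_complex[OF sum_sqrt_coeff_nonneg] psdBD[OF psdB_idop[OF X]]
        by (rule mult_nonneg_nonneg)
      also have "\<dots> = (\<Sum>k\<le>m. complex_of_real (sqrt_coeff k) * qform X idop v)"
        by (simp add: sum_distrib_right)
      also have "\<dots> \<le> (\<Sum>k\<le>m. complex_of_real (sqrt_coeff k) * qform X (opow X T k) v)"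
      proof (rule sum_mono)
        fix k
        have "0 \<le> complex_of_real (- sqrt_coeff k) * qform X (subop idop (opow X T k)) v"
        proof (cases k)
          case 0
          then show ?thesis by (simp add: qform_subop)
        next
          case (Suc l)
          show ?thesis
            by (intro mult_nonneg_nonneg of_real_nonneg_complex psdBD opow_contraction[OF X T])
              (use Suc sqrt_coeff_Suc_nonpos in auto)
        qed
        then show "complex_of_real (sqrt_coeff k) * qform X idop v
            \<le> complex_of_real (sqrt_coeff k) * qform X (opow X T k) v"
          by (simp add: qform_subop algebra_simps)
      qed
      finally show ?thesis .
    qed
    define S where "S m = (\<Sum>k\<le>m. complex_of_real (sqrt_coeff k) * qform X (opow X T k) v)" for m
    have S: "S \<longlonglongrightarrow> qform X (sqrt_series X T) v" using lim by (simp add: S_def[abs_def])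
    have pos: "0 \<le> Re (S m)" "Im (S m) = 0" for m
      using pos[of m, folded S_def] by (simp_all add: less_eq_complex_def)
    have "0 \<le> Re (qform X (sqrt_series X T) v)"
      using pos(1) by (intro LIMSEQ_le_const[OF tendsto_Re[OF S]]) blast
    moreover have "Im (qform X (sqrt_series X T) v) = 0"
      using tendsto_Im[OF S] pos(2) by (simp add: LIMSEQ_const_iff)
    ultimately show "0 \<le> qform X (sqrt_series X T) v" by (simp add: less_eq_complex_def)
  qed
  show "eq_on X (mulB X (sqrt_series X T) (sqrt_series X T)) (subop idop T)"
  proof (rule eq_onI)
    fix i j assume i: "i \<in> X" and j: "j \<in> X"
    let ?c = "\<lambda>k. complex_of_real (sqrt_coeff k)"
    \<comment> \<open>An entrywise Cauchy product: absolute convergence permits regrouping by the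
      total exponent \<open>n\<close>, where the convolution identity applies.\<close>
    have "(\<lambda>n. \<Sum>l\<in>X. \<Sum>k\<le>n. (?c k * opow X T k i l) * (?c (n - k) * opow X T (n - k) l j))
        sums mulB X (sqrt_series X T) (sqrt_series X T) i j"
      unfolding mulB_def sqrt_series_def by (intro sums_sum Cauchy_product_sums nsum i j)
    moreover have "(\<Sum>l\<in>X. \<Sum>k\<le>n. (?c k * opow X T k i l) * (?c (n - k) * opow X T (n - k) l j))
        = (if n = 0 then 1 else if n = 1 then -1 else 0) * opow X T n i j" for n
    proof -
      have "(\<Sum>l\<in>X. \<Sum>k\<le>n. (?c k * opow X T k i l) * (?c (n - k) * opow X T (n - k) l j))
          = (\<Sum>k\<le>n. ?c k * ?c (n - k) * mulB X (opow X T k) (opow X T (n - k)) i j)"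
        by (subst sum.swap) (simp add: mulB_def sum_distrib_left mult_ac)
      also have "\<dots> = (\<Sum>k\<le>n. ?c k * ?c (n - k) * opow X T n i j)"
        using eq_onD[OF opow_add[OF X] i j] by (intro sum.cong refl) simp
      also have "\<dots> = complex_of_real (\<Sum>k\<le>n. sqrt_coeff k * sqrt_coeff (n - k)) * opow X T n i j"
        by (simp add: sum_distrib_right)
      finally show ?thesis by (simp add: sqrt_coeff_convolution)
    qed
    ultimately have *: "(\<lambda>n. (if n = 0 then 1 else if n = 1 then -1 else 0) * opow X T n i j)
        sums mulB X (sqrt_series X T) (sqrt_series X T) i j" by (simp only:)
    have "(\<lambda>n. (if n = 0 then 1 else if n = 1 then -1 else 0) * opow X T n i j)
        sums (\<Sum>n\<in>{0,1}. (if n = 0 then 1 else if n = 1 then -1 else 0) * opow X T n i j)"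
      by (rule sums_finite) auto
    from sums_unique2[OF * this]
    show "mulB X (sqrt_series X T) (sqrt_series X T) i j = subop idop T i j"
      using X j by (simp add: subop_def mulB_idop_right)
  qed
qed

lemma psdB_le_multiple_of_idop:
  assumes X: "finite X" and A: "psdB X A"
  shows "\<exists>c>0. psdB X (subop (scaleop c idop) A)"
proof -
  define t where "t = (\<Sum>i\<in>X. Re (A i i))"
  \<comment> \<open>The factor \<open>card X\<close> comes from bounding the form by a sum over all
    pairs of entries; the summand \<open>1\<close> keeps \<open>c\<close> positive even for
    \<open>A = 0\<close>, so that it can be divided by.\<close>
  define c where "c = t * card X + 1"
  have diag: "0 \<le> Re (A i i)" if "i \<in> X" for i
    using psdB_diag[OF X A that] by (simp add: less_eq_complex_def)
  then have t0: "0 \<le> t" unfolding t_def by (rule sum_nonneg)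
  have le_t: "Re (A i i) \<le> t" if "i \<in> X" for i
    unfolding t_def using member_le_sum[of i X "\<lambda>i. Re (A i i)"] that diag X by auto
  have entry: "cmod (A i j) \<le> t" if "i \<in> X" "j \<in> X" for i j
    using psdB_entry_bound[OF X A that] le_t[OF that(1)] le_t[OF that(2)] by linarith
  have "0 \<le> qform X (subop (scaleop c idop) A) v" for v
  proof -
    define s where "s = (\<Sum>i\<in>X. (cmod (v i))\<^sup>2)"
    have s0: "0 \<le> s" unfolding s_def by (simp add: sum_nonneg)
    have "Re (qform X A v) \<le> cmod (qform X A v)" by (rule complex_Re_le_cmod)
    also have "\<dots> \<le> (\<Sum>i\<in>X. \<Sum>j\<in>X. cmod (cnj (v i) * A i j * v j))"
      unfolding qform_def by (intro order_trans[OF norm_sum] sum_mono order_refl)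
    also have "\<dots> \<le> (\<Sum>i\<in>X. \<Sum>j\<in>X. t * (((cmod (v i))\<^sup>2 + (cmod (v j))\<^sup>2) / 2))"
    proof (intro sum_mono)
      fix i j assume ij: "i \<in> X" "j \<in> X"
      have "cmod (v i) * cmod (v j) \<le> ((cmod (v i))\<^sup>2 + (cmod (v j))\<^sup>2) / 2"
        using sum_squares_bound[of "cmod (v i)" "cmod (v j)"] by simp
      then have "cmod (A i j) * (cmod (v i) * cmod (v j)) \<le> t * (((cmod (v i))\<^sup>2 + (cmod (v j))\<^sup>2) / 2)"
        by (intro mult_mono entry ij t0) auto
      then show "cmod (cnj (v i) * A i j * v j) \<le> t * (((cmod (v i))\<^sup>2 + (cmod (v j))\<^sup>2) / 2)"
        by (simp add: norm_mult mult_ac)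
    qed
    also have "\<dots> = t * card X * s"
      by (simp add: s_def sum.distrib sum_distrib_left[symmetric] sum_divide_distrib[symmetric]
          sum_distrib_right[symmetric] distrib_left)
    also have "\<dots> \<le> c * s" using s0 by (simp add: c_def algebra_simps)
    finally have "Re (qform X A v) \<le> c * s" .
    moreover have "qform X idop v = complex_of_real s" using X by (simp add: qform_idop s_def)
    moreover have "0 \<le> qform X A v" by (rule psdBD[OF A])
    ultimately show ?thesis
      by (simp add: qform_subop qform_scaleop less_eq_complex_def)
  qed
  moreover have "0 < c" using t0 by (simp add: c_def add_nonneg_pos)
  ultimately show ?thesis by (auto simp: psdB_iff_qform)
qed

lemma psdB_sqrt_exists:
  assumes X: "finite X" and A: "psdB X A"
  shows "\<exists>R. psdB X R \<and> eq_on X (mulB X R R) A \<and> (\<forall>i j. i \<notin> X \<or> j \<notin> X \<longrightarrow> R i j = 0)"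
proof -
  obtain c where c: "0 < c" "psdB X (subop (scaleop c idop) A)"
    using psdB_le_multiple_of_idop[OF X A] by blast
  \<comment> \<open>With this \<open>T\<close> the series squares to \<open>I - T\<close>, which is
    \<open>A\<close> scaled by \<open>1/c\<close>; the factor \<open>sqrt c\<close> in
    \<open>R0\<close> undoes the scaling.\<close>
  define T where "T = subop idop (scaleop (1/c) A)"
  have "T = scaleop (1/c) (subop (scaleop c idop) A)"
    using c(1) by (simp add: T_def subop_def scaleop_def fun_eq_iff field_simps)
  then have T1: "psdB X T" using psdB_scaleop[OF _ c(2), of "1/c"] c(1) by simp
  have iT: "subop idop T = scaleop (1/c) A" by (simp add: T_def subop_def)
  then have T2: "psdB X (subop idop T)" using psdB_scaleop[OF _ A, of "1/c"] c(1) by simp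
  define R0 where "R0 = scaleop (sqrt c) (sqrt_series X T)"
  have R0: "psdB X R0" unfolding R0_def using c(1) by (intro psdB_scaleop sqrt_series_props X T1 T2) simp
  have sc: "complex_of_real (sqrt c) * complex_of_real (sqrt c) = complex_of_real c"
    using c(1) by (simp flip: of_real_mult)
  have "eq_on X (mulB X R0 R0) A"
    using sqrt_series_props(2)[OF X T1 T2] c(1) sc
    by (simp add: R0_def mulB_scaleop_left mulB_scaleop_right iT eq_on_def)
      (simp add: scaleop_def flip: mult.assoc)
  \<comment> \<open>Clearing the entries outside \<open>X\<close> meets the normalisation built into
    \<open>sqrt_op\<close>.\<close>
  moreover define R where "R = (\<lambda>i j. if i \<in> X \<and> j \<in> X then R0 i j else 0)"
  moreover have "eq_on X R0 R" by (simp add: R_def eq_on_def)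
  ultimately have "psdB X R" "eq_on X (mulB X R R) A"
    using R0 psdB_cong[of X R0 R] eq_on_trans[OF eq_on_sym[OF mulB_cong[of X R0 R R0 R]]] by simp_all
  then show ?thesis by (auto simp: R_def)
qed

section \<open>Traces on a finite basis and uniqueness of the square root\<close>

lemma finite_basis [simp]: "finite (basis (d :: 'v::finite \<Rightarrow> nat) qs)"
proof -
  have "basis d qs \<subseteq> {f. \<forall>x. (x \<in> qs \<longrightarrow> f x \<in> {..<Suc (Max (range d))}) \<and> (x \<notin> qs \<longrightarrow> f x = 0)}"
  proof (intro subsetI CollectI allI conjI impI)
    fix f x assume f: "f \<in> basis d qs"
    { assume "x \<in> qs"
      then have "f x < d x" using f by (simp add: basis_def)
      also have "d x \<le> Max (range d)" by simp
      finally show "f x \<in> {..<Suc (Max (range d))}" by simp }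
    { assume "x \<notin> qs"
      then show "f x = 0" using f by (simp add: basis_def) }
  qed
  then show ?thesis by (rule finite_subset) (rule finite_set_of_finite_funs; simp)
qed

lemma trace_psd_nonneg:
  fixes d :: "'v::finite \<Rightarrow> nat"
  shows "psdB (fullb d) A \<Longrightarrow> 0 \<le> trace d A"
  unfolding trace_def by (rule sum_nonneg) (rule psdB_diag[OF finite_basis])

text \<open>Twice an entry is bounded by two diagonal entries, each at most the trace. The bound
  makes positive operators of trace zero vanish and later gives convergence of loops from
  convergence of traces.\<close>

lemma psd_trace_bound:
  fixes d :: "'v::finite \<Rightarrow> nat"
  assumes A: "psdB (fullb d) A" and ij: "i \<in> fullb d" "j \<in> fullb d"
  shows "cmod (A i j) \<le> Re (trace d A)"
proof -
  have "Re (A k k) \<le> Re (trace d A)" if "k \<in> fullb d" for k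
    using member_le_sum[of k "fullb d" "\<lambda>i. Re (A i i)"] that psdB_diag[OF finite_basis A]
    by (auto simp: trace_def less_eq_complex_def)
  from this[OF ij(1)] this[OF ij(2)] show ?thesis using psdB_entry_bound[OF finite_basis A ij] by linarith
qed

lemma psd_trace_0:
  fixes d :: "'v::finite \<Rightarrow> nat"
  assumes "psdB (fullb d) A" "trace d A = 0"
  shows "eq_on (fullb d) A zeroop"
  using psd_trace_bound[OF assms(1)] assms(2) by (auto simp: eq_on_def zeroop_def)

text \<open>A diagonal entry of the product is the sum of the squared moduli in one column of
  \<open>A\<close>.\<close>

lemma adj_mul_self_eq_0:
  fixes d :: "'v::finite \<Rightarrow> nat"
  assumes "eq_on (fullb d) (mul d (adj A) A) zeroop"
  shows "eq_on (fullb d) A zeroop"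
proof (rule eq_onI)
  fix i j assume i: "i \<in> fullb d" and j: "j \<in> fullb d"
  have "mul d (adj A) A j j = (\<Sum>k\<in>fullb d. complex_of_real ((cmod (A k j))\<^sup>2))"
    unfolding mulB_def adj_def
    by (intro sum.cong refl) (simp only: complex_norm_square mult.commute)
  then have "(\<Sum>k\<in>fullb d. (cmod (A k j))\<^sup>2) = 0"
    using eq_onD[OF assms j j] by (simp add: zeroop_def flip: of_real_sum of_real_power)
  then show "A i j = zeroop i j"
    using i by (simp add: sum_nonneg_eq_0_iff zeroop_def)
qed

lemma psd_sqrt_unique:
  fixes d :: "'v::finite \<Rightarrow> nat"
  assumes R: "psdB (fullb d) R" and R': "psdB (fullb d) R'"
    and eq: "eq_on (fullb d) (mul d R R) (mul d R' R')"
  shows "eq_on (fullb d) R R'"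
proof -
  let ?X = "fullb d"
  define D where "D = subop R R'"
  have D_adj: "eq_on ?X (adj D) D"
    using psdB_adj[OF finite_basis R] psdB_adj[OF finite_basis R']
    by (simp add: D_def adj_def subop_def eq_on_def)
  let ?DRD = "mul d (mul d D R) D" and ?DRD' = "mul d (mul d D R') D"
  have psd: "psdB ?X ?DRD" "psdB ?X ?DRD'"
    by (rule psdB_conjugate_hermitian[OF D_adj] R R')+
  \<comment> \<open>\<open>R\<close> and \<open>R'\<close> may fail to commute; in the symmetrised
    product the mixed terms cancel and twice the difference of the two squares remains.\<close>
  have "eq_on ?X (addop (mul d (addop R R') D) (mul d D (addop R R'))) zeroop"
    using eq
    by (simp add: D_def mulB_addop_left mulB_addop_right mulB_subop_left mulB_subop_right eq_on_def)
      (simp add: addop_def subop_def zeroop_def)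
  \<comment> \<open>After multiplication by \<open>D\<close> both summands have the same trace by
    cyclicity, so that common trace is zero.\<close>
  then have "eq_on ?X (mul d D (addop (mul d (addop R R') D) (mul d D (addop R R')))) (mul d D zeroop)"
    by (intro mulB_cong) auto
  then have "trace d (mul d D (mul d (addop R R') D)) + trace d (mul d D (mul d D (addop R R'))) = trace d (mul d D zeroop)"
    unfolding mulB_addop_right[of _ _ "mul d (addop R R') D"] trace_addop[symmetric] by (rule trace_cong)
  moreover have "trace d (mul d D (mul d D (addop R R'))) = trace d (mul d D (mul d (addop R R') D))"
    by (subst mulB_assoc[symmetric], subst trace_mul_commute) (simp add: mulB_assoc)
  moreover have "trace d (mul d D zeroop) = 0" by (simp add: trace_def mulB_def zeroop_def)
  moreover have "mul d D (mul d (addop R R') D) = addop ?DRD ?DRD'"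
    by (simp add: mulB_assoc mulB_addop_left mulB_addop_right)
  ultimately have "2 * (trace d ?DRD + trace d ?DRD') = 0"
    by (simp add: trace_addop)
  then have "trace d ?DRD + trace d ?DRD' = 0" by (simp only: mult_eq_0_iff) simp
  then have "trace d ?DRD = 0" "trace d ?DRD' = 0"
    using trace_psd_nonneg[OF psd(1)] trace_psd_nonneg[OF psd(2)] add_nonneg_eq_0_iff by blast+
  then have "eq_on ?X ?DRD zeroop" "eq_on ?X ?DRD' zeroop"
    using psd_trace_0 psd by blast+
  \<comment> \<open>Expanding the middle \<open>D\<close> as \<open>R - R'\<close> writes the cube
    as a difference of two vanishing products.\<close>
  then have D3: "eq_on ?X (mul d (mul d D D) D) zeroop"
    by (subst (2) D_def, unfold mulB_subop_left mulB_subop_right) (simp add: eq_on_def subop_def zeroop_def)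
  \<comment> \<open>A hermitian operator with zero square is zero. This is used first for
    \<open>D\<^sup>2\<close>, whose square contains the factor \<open>D\<^sup>3\<close>, and then
    for \<open>D\<close>.\<close>
  have adjD2: "eq_on ?X (adj (mul d D D)) (mul d D D)"
    unfolding adj_mulB by (intro mulB_cong D_adj)
  have "eq_on ?X (mul d (adj (mul d D D)) (mul d D D)) (mul d (mul d D D) (mul d D D))"
    by (rule mulB_cong[OF adjD2 eq_on_refl])
  also have "mul d (mul d D D) (mul d D D) = mul d (mul d (mul d D D) D) D"
    by (simp add: mulB_assoc)
  also have "eq_on ?X (mul d (mul d (mul d D D) D) D) (mul d zeroop D)"
    by (rule mulB_cong[OF D3 eq_on_refl])
  also have "mul d zeroop D = zeroop" by (simp add: mulB_def zeroop_def)
  finally have "eq_on ?X (mul d D D) zeroop" by (rule adj_mul_self_eq_0)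
  moreover have "eq_on ?X (mul d (adj D) D) (mul d D D)" by (rule mulB_cong[OF D_adj eq_on_refl])
  ultimately have "eq_on ?X (mul d (adj D) D) zeroop" by (simp add: eq_on_def)
  then have "eq_on ?X D zeroop" by (rule adj_mul_self_eq_0)
  then show ?thesis by (simp add: D_def eq_on_def subop_def zeroop_def)
qed

text \<open>Uniqueness holds only on the basis; the zero entries elsewhere extend it to equality of
  functions, as the definite description demands.\<close>

lemma sqrt_op_props:
  fixes d :: "'v::finite \<Rightarrow> nat"
  assumes "psdB (fullb d) M"
  shows "psdB (fullb d) (sqrt_op d M)" "eq_on (fullb d) (mul d (sqrt_op d M) (sqrt_op d M)) M"
proof -
  let ?P = "\<lambda>R. psdB (fullb d) R \<and> eq_on (fullb d) (mul d R R) M \<and>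
      (\<forall>i j. i \<notin> fullb d \<or> j \<notin> fullb d \<longrightarrow> R i j = 0)"
  obtain R where R: "?P R" using psdB_sqrt_exists[OF finite_basis assms] by blast
  have uniq: "R' = R" if R': "?P R'" for R'
  proof (intro ext)
    fix i j
    have "eq_on (fullb d) (mul d R' R') (mul d R R)" using R R' by (simp add: eq_on_def)
    then have "eq_on (fullb d) R' R" using psd_sqrt_unique[of d R' R] R R' by simp
    then show "R' i j = R i j" using R R' by (cases "i \<in> fullb d \<and> j \<in> fullb d") (auto simp: eq_on_def)
  qed
  have "sqrt_op d M = R" unfolding sqrt_op_def using R uniq by (rule the_equality)
  then show "psdB (fullb d) (sqrt_op d M)" "eq_on (fullb d) (mul d (sqrt_op d M) (sqrt_op d M)) M"
    using R by simp_all
qed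

subsection \<open>Embedding of subsystems\<close>

lemma restr_in_basis: "m \<in> fullb d \<Longrightarrow> restr qs m \<in> basis d qs"
  by (simp add: basis_def restr_def)

lemma lift_cong: "eq_on (basis d qs) A B \<Longrightarrow> eq_on (fullb d) (lift qs A) (lift qs B)"
  by (auto simp: eq_on_def lift_def restr_in_basis)

lemma lift_idop [simp]: "lift qs idop = idop"
proof -
  have "i = j" if "\<forall>v. v \<notin> qs \<longrightarrow> i v = j v" "restr qs i = restr qs j" for i j :: "'a mem"
    using that by (auto simp: restr_def fun_eq_iff split: if_splits)
  then show ?thesis unfolding lift_def idop_def by (intro ext) auto
qed

lemma adj_lift: "adj (lift qs A) = lift qs (adj A)"
proof (intro ext)
  fix i j :: "'a mem"
  have "(\<forall>v. v \<notin> qs \<longrightarrow> j v = i v) = (\<forall>v. v \<notin> qs \<longrightarrow> i v = j v)" by auto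
  then show "adj (lift qs A) i j = lift qs (adj A) i j"
    unfolding adj_def lift_def by (simp only: if_distrib[of cnj] complex_cnj_zero)
qed

lemma lift_addop: "lift qs (addop A B) = addop (lift qs A) (lift qs B)"
  by (intro ext) (auto simp: lift_def addop_def)

lemma lift_subop: "lift qs (subop A B) = subop (lift qs A) (lift qs B)"
  by (intro ext) (auto simp: lift_def subop_def)

lemma lift_sumlistop: "lift qs (sumlistop As) = sumlistop (map (lift qs) As)"
  by (induction As) (simp_all add: sumlistop_def lift_addop, simp add: lift_def zeroop_def)

lemma mul_lift:
  fixes d :: "'v::finite \<Rightarrow> nat"
  shows "eq_on (fullb d) (mul d (lift qs A) (lift qs B)) (lift qs (mulB (basis d qs) A B))"
proof (rule eq_onI)
  fix i j assume i: "i \<in> fullb d" and j: "j \<in> fullb d"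
  let ?agree = "\<lambda>k l. \<forall>v. v \<notin> qs \<longrightarrow> k v = (l v :: nat)"
  show "mul d (lift qs A) (lift qs B) i j = lift qs (mulB (basis d qs) A B) i j"
  proof (cases "?agree i j")
    case True
    have "mul d (lift qs A) (lift qs B) i j
        = (\<Sum>k\<in>{k\<in>fullb d. ?agree i k}. A (restr qs i) (restr qs k) * B (restr qs k) (restr qs j))"
      unfolding mulB_def using True by (intro sum.mono_neutral_cong_right) (auto simp: lift_def)
    \<comment> \<open>Memories agreeing with \<open>i\<close> outside \<open>qs\<close> correspond
      to basis states of the subsystem; the inverse of \<open>restr qs\<close> fills in the values
      of \<open>i\<close>.\<close>
    also have "\<dots> = (\<Sum>a\<in>basis d qs. A (restr qs i) a * B a (restr qs j))"
      by (rule sum.reindex_bij_witness[of _ "\<lambda>a v. if v \<in> qs then a v else i v" "restr qs"])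
        (use i in \<open>auto simp: basis_def restr_def fun_eq_iff\<close>)
    finally show ?thesis using True by (simp add: lift_def mulB_def)
  next
    case False
    then have "lift qs A i k * lift qs B k j = 0" for k by (auto simp: lift_def)
    then have "mul d (lift qs A) (lift qs B) i j = 0" by (simp only: mulB_def sum.neutral_const)
    then show ?thesis using False by (auto simp: lift_def)
  qed
qed

text \<open>A positive root of \<open>M\<close> on the subsystem lifts to an operator that is
  hermitian and squares to \<open>lift qs M\<close> on the full basis, and squares of hermitian
  operators are positive.\<close>

lemma lift_psd:
  fixes d :: "'v::finite \<Rightarrow> nat"
  assumes "psdB (basis d qs) M"
  shows "psdB (fullb d) (lift qs M)"
proof -
  obtain R where R: "psdB (basis d qs) R" "eq_on (basis d qs) (mulB (basis d qs) R R) M"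
    using psdB_sqrt_exists[OF finite_basis assms] by blast
  let ?L = "lift qs R"
  have adj: "eq_on (fullb d) (adj ?L) ?L"
    unfolding adj_lift by (rule lift_cong) (rule psdB_adj[OF finite_basis R(1)])
  have "eq_on (fullb d) (mul d (mul d ?L idop) ?L) (mul d ?L ?L)"
    by (rule mulB_cong) (simp_all add: eq_on_def mulB_idop_right)
  also have "eq_on (fullb d) (mul d ?L ?L) (lift qs (mulB (basis d qs) R R))" by (rule mul_lift)
  also have "eq_on (fullb d) (lift qs (mulB (basis d qs) R R)) (lift qs M)" by (rule lift_cong[OF R(2)])
  finally show ?thesis
    using psdB_conjugate_hermitian[OF adj psdB_idop[OF finite_basis]] psdB_cong by blast
qed

section \<open>Trace duality and rank-one test operators\<close>

lemma trace_conjugate: "trace d (mul d (mul d K A) K') = trace d (mul d (mul d K' K) A)"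
  by (subst trace_mul_commute) (simp add: mulB_assoc)

text \<open>Cyclicity of the trace moves a conjugation from the state to the predicate; the
  preconditions of all primitive statements arise this way.\<close>

lemma trace_conjugate_dual:
  "trace d (mul d (mul d (mul d K' Q) K) A) = trace d (mul d Q (mul d (mul d K A) K'))"
proof -
  have "trace d (mul d (mul d (mul d K' Q) K) A) = trace d (mul d K' (mul d Q (mul d K A)))"
    by (simp add: mulB_assoc)
  also have "\<dots> = trace d (mul d (mul d Q (mul d K A)) K')" by (rule trace_mul_commute)
  finally show ?thesis by (simp add: mulB_assoc)
qed

text \<open>Splitting \<open>A\<close> into two roots and cycling one of them round gives the trace
  of \<open>Q\<close> conjugated by the root of \<open>A\<close>.\<close>

lemma trace_mul_psd_nonneg:
  fixes d :: "'v::finite \<Rightarrow> nat"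
  assumes Q: "psdB (fullb d) Q" and A: "psdB (fullb d) A"
  shows "0 \<le> trace d (mul d Q A)"
proof -
  let ?R = "sqrt_op d A"
  have "trace d (mul d Q A) = trace d (mul d Q (mul d ?R ?R))"
    by (intro trace_cong mulB_cong eq_on_sym[OF sqrt_op_props(2)[OF A]]) simp
  also have "\<dots> = trace d (mul d (mul d ?R Q) ?R)"
    by (subst mulB_assoc[symmetric], subst trace_mul_commute) (simp add: mulB_assoc)
  finally show ?thesis
    using trace_psd_nonneg[OF psdB_conjugate_hermitian[OF psdB_adj[OF finite_basis sqrt_op_props(1)[OF A]] Q]]
    by simp
qed

definition outer :: "('v mem \<Rightarrow> complex) \<Rightarrow> 'v op" where
  "outer v = (\<lambda>i j. v i * cnj (v j))"

lemma psdB_outer: "psdB X (outer v)"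
proof (rule psdBI)
  fix w
  have "qform X (outer v) w = (\<Sum>i\<in>X. cnj (w i) * v i) * cnj (\<Sum>i\<in>X. cnj (w i) * v i)"
    by (simp add: qform_def outer_def sum_product mult_ac)
  also have "\<dots> = complex_of_real ((cmod (\<Sum>i\<in>X. cnj (w i) * v i))\<^sup>2)"
    by (rule complex_norm_square[symmetric])
  finally show "0 \<le> qform X (outer v) w" by (simp only: of_real_nonneg_complex zero_le_power2)
qed

lemma trace_mul_outer: "trace d (mul d A (outer v)) = qform (fullb d) A v"
  by (simp add: trace_def mulB_def outer_def qform_def mult_ac)

text \<open>Loewner inequalities are tested on rank-one states, rescaled to trace at most one.\<close>

lemma loewnerI_states:
  fixes d :: "'v::finite \<Rightarrow> nat"
  assumes A: "psdB (fullb d) A" and B: "psdB (fullb d) B"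
    and le: "\<And>\<rho>. partial_state d \<rho> \<Longrightarrow> Re (trace d (mul d A \<rho>)) \<le> Re (trace d (mul d B \<rho>))"
  shows "loewner d A B"
  unfolding loewnerB_def
proof (rule psdBI)
  fix v
  let ?X = "fullb d"
  define t where "t = Re (trace d (outer v))"
  have t0: "0 \<le> t" using trace_psd_nonneg[OF psdB_outer, of d v] by (simp add: t_def less_eq_complex_def)
  define \<rho> where "\<rho> = scaleop (1 / (1 + t)) (outer v)"
  have "partial_state d \<rho>"
    using t0 by (simp add: partial_state_def \<rho>_def psdB_scaleop psdB_outer trace_scaleop t_def[symmetric])
  from le[OF this] have "Re (qform ?X A v) / (1 + t) \<le> Re (qform ?X B v) / (1 + t)"
    by (simp add: \<rho>_def mulB_scaleop_right trace_scaleop trace_mul_outer)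
  then have "Re (qform ?X A v) \<le> Re (qform ?X B v)" using t0 by (simp add: divide_le_cancel)
  then show "0 \<le> qform ?X (subop B A) v"
    using psdBD[OF A, of v] psdBD[OF B, of v] by (simp add: qform_subop less_eq_complex_def)
qed

lemma is_pred_iff: "is_pred d P \<longleftrightarrow> psdB (fullb d) P \<and> psdB (fullb d) (subop idop P)"
  by (simp add: is_pred_def loewnerB_def subop_def zeroop_def)

subsection \<open>Linear functionals on operators\<close>

text \<open>Linearity is encoded as a coefficient representation, which also says that only entries
  indexed by the basis matter. The coefficients yield a matrix for the functional at once.\<close>

definition linfun :: "('v \<Rightarrow> nat) \<Rightarrow> ('v op \<Rightarrow> complex) \<Rightarrow> bool" where
  "linfun d f \<longleftrightarrow> (\<exists>k. \<forall>\<rho>. f \<rho> = (\<Sum>a\<in>fullb d. \<Sum>b\<in>fullb d. k a b * \<rho> a b))"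

definition oplinear :: "('v \<Rightarrow> nat) \<Rightarrow> ('v op \<Rightarrow> 'v op) \<Rightarrow> bool" where
  "oplinear d \<Phi> \<longleftrightarrow> (\<forall>i\<in>fullb d. \<forall>j\<in>fullb d. linfun d (\<lambda>\<rho>. \<Phi> \<rho> i j))"

lemma linfun_entry:
  fixes d :: "'v::finite \<Rightarrow> nat"
  assumes "i \<in> fullb d" "j \<in> fullb d"
  shows "linfun d (\<lambda>\<rho>. \<rho> i j)"
proof -
  have "\<rho> i j = (\<Sum>a\<in>fullb d. \<Sum>b\<in>fullb d. (if a = i then if b = j then 1 else 0 else 0) * \<rho> a b)"
    for \<rho> :: "'v op"
  proof -
    have "(\<Sum>b\<in>fullb d. (if a = i then if b = j then 1 else 0 else 0) * \<rho> a b) = (if a = i then \<rho> i j else 0)" for a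
      using assms by (simp add: if_distrib[of "\<lambda>x. x * _"] cong: if_cong)
    then show ?thesis using assms by simp
  qed
  then show ?thesis unfolding linfun_def
    by (intro exI[of _ "\<lambda>a b. if a = i then if b = j then 1 else 0 else 0"] allI)
qed

lemma linfun_add: "linfun d f \<Longrightarrow> linfun d g \<Longrightarrow> linfun d (\<lambda>\<rho>. f \<rho> + g \<rho>)"
proof -
  assume "linfun d f" "linfun d g"
  then obtain k l where "\<forall>\<rho>. f \<rho> = (\<Sum>a\<in>fullb d. \<Sum>b\<in>fullb d. k a b * \<rho> a b)"
    "\<forall>\<rho>. g \<rho> = (\<Sum>a\<in>fullb d. \<Sum>b\<in>fullb d. l a b * \<rho> a b)" unfolding linfun_def by blast
  then have "\<forall>\<rho>. f \<rho> + g \<rho> = (\<Sum>a\<in>fullb d. \<Sum>b\<in>fullb d. (k a b + l a b) * \<rho> a b)"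
    by (simp add: distrib_right sum.distrib)
  then show ?thesis unfolding linfun_def by (rule exI[of _ "\<lambda>a b. k a b + l a b"])
qed

lemma linfun_cmult: "linfun d f \<Longrightarrow> linfun d (\<lambda>\<rho>. c * f \<rho>)"
proof -
  assume "linfun d f"
  then obtain k where "\<forall>\<rho>. f \<rho> = (\<Sum>a\<in>fullb d. \<Sum>b\<in>fullb d. k a b * \<rho> a b)"
    unfolding linfun_def by blast
  then have "\<forall>\<rho>. c * f \<rho> = (\<Sum>a\<in>fullb d. \<Sum>b\<in>fullb d. (c * k a b) * \<rho> a b)"
    by (simp add: sum_distrib_left mult.assoc)
  then show ?thesis unfolding linfun_def by (rule exI[of _ "\<lambda>a b. c * k a b"])
qed

lemma linfun_multc: "linfun d f \<Longrightarrow> linfun d (\<lambda>\<rho>. f \<rho> * c)"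
  using linfun_cmult[of d f c] by (simp add: mult.commute)

lemma linfun_diff: "linfun d f \<Longrightarrow> linfun d g \<Longrightarrow> linfun d (\<lambda>\<rho>. f \<rho> - g \<rho>)"
  using linfun_add[OF _ linfun_cmult[of d g "-1"]] by simp

lemma linfun_zero: "linfun d (\<lambda>\<rho>. 0)"
  unfolding linfun_def by (rule exI[of _ "\<lambda>a b. 0"]) simp

lemma linfun_sum: "(\<And>y. y \<in> Y \<Longrightarrow> linfun d (f y)) \<Longrightarrow> linfun d (\<lambda>\<rho>. \<Sum>y\<in>Y. f y \<rho>)"
  by (induction Y rule: infinite_finite_induct) (simp_all add: linfun_zero linfun_add)

lemma linfun_compose:
  assumes f: "linfun d f" and \<Phi>: "oplinear d \<Phi>"
  shows "linfun d (\<lambda>\<rho>. f (\<Phi> \<rho>))"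
proof -
  obtain k where k: "\<forall>\<rho>. f \<rho> = (\<Sum>a\<in>fullb d. \<Sum>b\<in>fullb d. k a b * \<rho> a b)"
    using f unfolding linfun_def by blast
  have "linfun d (\<lambda>\<rho>. \<Sum>a\<in>fullb d. \<Sum>b\<in>fullb d. k a b * \<Phi> \<rho> a b)"
    using \<Phi> by (intro linfun_sum linfun_cmult) (simp add: oplinear_def)
  then show ?thesis using k by simp
qed

lemma linfun_trace: "linfun (d :: 'v::finite \<Rightarrow> nat) (trace d)"
  unfolding trace_def by (intro linfun_sum linfun_entry)

lemma linfun_trace_mul: "linfun (d :: 'v::finite \<Rightarrow> nat) (\<lambda>\<rho>. trace d (mul d Q \<rho>))"
  unfolding trace_def mulB_def by (intro linfun_sum linfun_cmult linfun_entry)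

lemma linfun_apply_add: "linfun d f \<Longrightarrow> f (\<lambda>i j. A i j + B i j) = f A + f B"
  unfolding linfun_def by (auto simp: distrib_left sum.distrib)

lemma linfun_apply_cmult: "linfun d f \<Longrightarrow> f (\<lambda>i j. c * A i j) = c * f A"
  unfolding linfun_def by (auto simp: sum_distrib_left mult_ac)

text \<open>The coefficients are recovered as values on matrix units, so limits of functionals
  reduce to limits of finitely many numbers.\<close>

lemma linfun_kernel:
  fixes d :: "'v::finite \<Rightarrow> nat"
  assumes "linfun d f"
  shows "f \<rho> = (\<Sum>a\<in>fullb d. \<Sum>b\<in>fullb d. f (ketbra a b) * \<rho> a b)"
proof -
  obtain k where k: "\<And>\<rho>. f \<rho> = (\<Sum>a\<in>fullb d. \<Sum>b\<in>fullb d. k a b * \<rho> a b)"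
    using assms unfolding linfun_def by blast
  have "f (ketbra a b) = k a b" if "a \<in> fullb d" "b \<in> fullb d" for a b
  proof -
    have "(\<Sum>b'\<in>fullb d. k a' b' * ketbra a b a' b') = (if a' = a then k a b else 0)" for a'
      using that by (simp add: ketbra_def if_distrib[of "\<lambda>x. _ * x"] cong: if_cong)
    then show ?thesis using that by (simp add: k)
  qed
  then show ?thesis using k by simp
qed

text \<open>With \<open>c\<close> ranging over the fourth roots of unity, weighting
  \<open>outer (v c)\<close> by \<open>c\<close> cancels everything except the
  \<open>a\<close>-\<open>b\<close> term, as the sums of \<open>c\<close> and of
  \<open>c\<^sup>2\<close> vanish. Matrix units thus become combinations of positive
  operators.\<close>

lemma ketbra_polarization:
  fixes a b :: "'v mem"
  defines "v \<equiv> \<lambda>c k. (if k = a then 1 else 0) + c * (if k = b then 1 else 0)"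
  shows "ketbra a b = (\<lambda>i j. 1/4 * (outer (v 1) i j + (\<i> * outer (v \<i>) i j +
    (- 1 * outer (v (-1)) i j + - \<i> * outer (v (-\<i>)) i j))))"
  by (auto simp: ketbra_def outer_def v_def fun_eq_iff algebra_simps)

text \<open>Convergence can be controlled by traces only on positive operators; polarization carries
  it to matrix units and linearity to all operators.\<close>

lemma linfun_summable:
  fixes d :: "'v::finite \<Rightarrow> nat" and f :: "nat \<Rightarrow> 'v op \<Rightarrow> complex"
  assumes f: "\<And>n. linfun d (f n)"
    and psd: "\<And>\<rho>. psdB (fullb d) \<rho> \<Longrightarrow> summable (\<lambda>n. f n \<rho>)"
  shows "summable (\<lambda>n. f n \<rho>)"
proof -
  have "summable (\<lambda>n. f n (ketbra a b))" for a b
    unfolding ketbra_polarization linfun_apply_cmult[OF f] linfun_apply_add[OF f]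
    by (intro summable_add summable_mult psd psdB_outer)
  then have "summable (\<lambda>n. \<Sum>a\<in>fullb d. \<Sum>b\<in>fullb d. f n (ketbra a b) * \<rho> a b)"
    by (intro summable_sum summable_mult2)
  then show ?thesis by (simp flip: linfun_kernel[OF f])
qed

lemma linfun_suminf:
  fixes d :: "'v::finite \<Rightarrow> nat" and f :: "nat \<Rightarrow> 'v op \<Rightarrow> complex"
  assumes f: "\<And>n. linfun d (f n)" and sm: "\<And>\<rho>. summable (\<lambda>n. f n \<rho>)"
  shows "linfun d (\<lambda>\<rho>. \<Sum>n. f n \<rho>)"
proof -
  have "(\<Sum>n. f n \<rho>) = (\<Sum>a\<in>fullb d. \<Sum>b\<in>fullb d. (\<Sum>n. f n (ketbra a b)) * \<rho> a b)" for \<rho>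
  proof -
    have "(\<lambda>n. \<Sum>a\<in>fullb d. \<Sum>b\<in>fullb d. f n (ketbra a b) * \<rho> a b) sums
        (\<Sum>a\<in>fullb d. \<Sum>b\<in>fullb d. (\<Sum>n. f n (ketbra a b)) * \<rho> a b)"
      by (intro sums_sum sums_mult2 summable_sums sm)
    then show ?thesis by (simp add: sums_iff flip: linfun_kernel[OF f])
  qed
  then show ?thesis unfolding linfun_def
    by (intro exI[of _ "\<lambda>a b. \<Sum>n. f n (ketbra a b)"] allI)
qed

lemma oplinear_id: "oplinear (d :: 'v::finite \<Rightarrow> nat) (\<lambda>\<rho>. \<rho>)"
  by (simp add: oplinear_def linfun_entry)

lemma oplinear_compose: "oplinear d \<Phi> \<Longrightarrow> oplinear d \<Psi> \<Longrightarrow> oplinear d (\<lambda>\<rho>. \<Phi> (\<Psi> \<rho>))"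
  unfolding oplinear_def[of d \<Phi>] oplinear_def[of d "\<lambda>\<rho>. \<Phi> (\<Psi> \<rho>)"]
  using linfun_compose by blast

lemma oplinear_conjugate: "oplinear (d :: 'v::finite \<Rightarrow> nat) (\<lambda>\<rho>. mul d (mul d K \<rho>) K')"
  unfolding oplinear_def mulB_def
  by (intro ballI linfun_sum linfun_multc linfun_cmult linfun_entry)

lemma oplinear_sumop: "(\<And>y. y \<in> Y \<Longrightarrow> oplinear d (\<Phi> y)) \<Longrightarrow> oplinear d (\<lambda>\<rho>. sumop Y (\<lambda>y. \<Phi> y \<rho>))"
  unfolding oplinear_def sumop_def by (auto intro!: linfun_sum)

lemma oplinear_sumlistop:
  "(\<And>c. c \<in> set cs \<Longrightarrow> oplinear d (\<Phi> c)) \<Longrightarrow> oplinear d (\<lambda>\<rho>. sumlistop (map (\<lambda>c. \<Phi> c \<rho>) cs))"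
  by (induction cs) (auto simp: oplinear_def sumlistop_def addop_def zeroop_def intro!: linfun_zero linfun_add)

subsection \<open>Trace-nonincreasing positive maps and weakest liberal preconditions\<close>

definition qop :: "('v \<Rightarrow> nat) \<Rightarrow> ('v op \<Rightarrow> 'v op) \<Rightarrow> bool" where
  "qop d \<Phi> \<longleftrightarrow> oplinear d \<Phi> \<and>
    (\<forall>\<rho>. psdB (fullb d) \<rho> \<longrightarrow> psdB (fullb d) (\<Phi> \<rho>) \<and> Re (trace d (\<Phi> \<rho>)) \<le> Re (trace d \<rho>))"

text \<open>The right-hand side is the bound in \<open>valid_par\<close>. Equality is required for
  every operator rather than only for states, so the identity applies to any intermediate result
  without a side condition.\<close>

definition is_wlp :: "('v \<Rightarrow> nat) \<Rightarrow> ('v op \<Rightarrow> 'v op) \<Rightarrow> 'v op \<Rightarrow> 'v op \<Rightarrow> bool" where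
  "is_wlp d \<Phi> Q W \<longleftrightarrow>
    (\<forall>\<rho>. trace d (mul d W \<rho>) = trace d (mul d Q (\<Phi> \<rho>)) + trace d \<rho> - trace d (\<Phi> \<rho>))"

lemma is_wlp_exists:
  fixes d :: "'v::finite \<Rightarrow> nat"
  assumes \<Phi>: "oplinear d \<Phi>"
  shows "\<exists>W. is_wlp d \<Phi> Q W"
proof -
  have "linfun d (\<lambda>\<rho>. trace d (mul d Q (\<Phi> \<rho>)) + trace d \<rho> - trace d (\<Phi> \<rho>))"
    by (intro linfun_diff linfun_add linfun_compose[OF linfun_trace_mul \<Phi>] linfun_trace
        linfun_compose[OF linfun_trace \<Phi>])
  then obtain k where k: "\<And>\<rho>. trace d (mul d Q (\<Phi> \<rho>)) + trace d \<rho> - trace d (\<Phi> \<rho>) =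
      (\<Sum>a\<in>fullb d. \<Sum>b\<in>fullb d. k a b * \<rho> a b)" unfolding linfun_def by blast
  \<comment> \<open>The representing matrix is the transpose of the coefficient matrix, because the
    trace pairs entry \<open>(b, a)\<close> of one factor with entry \<open>(a, b)\<close> of the
    other.\<close>
  have "trace d (mul d (\<lambda>b a. k a b) \<rho>) = (\<Sum>a\<in>fullb d. \<Sum>b\<in>fullb d. k a b * \<rho> a b)" for \<rho>
    unfolding trace_def mulB_def by (rule sum.swap)
  then show ?thesis unfolding is_wlp_def k by blast
qed

lemma trace_mul_idop: "trace (d :: 'v::finite \<Rightarrow> nat) (mul d idop \<rho>) = trace d \<rho>"
  by (simp add: trace_def mulB_idop_left)

text \<open>On \<open>\<rho> = outer v\<close> the form of \<open>W\<close> is the trace of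
  \<open>Q (\<Phi> \<rho>)\<close> plus the trace lost by \<open>\<Phi>\<close>, and the form of
  \<open>I - W\<close> is the trace of \<open>(I - Q) (\<Phi> \<rho>)\<close>; both are
  nonnegative.\<close>

lemma is_wlp_pred:
  fixes d :: "'v::finite \<Rightarrow> nat"
  assumes \<Phi>: "qop d \<Phi>" and Q: "is_pred d Q" and W: "is_wlp d \<Phi> Q W"
  shows "is_pred d W"
proof -
  have "0 \<le> qform (fullb d) W v \<and> 0 \<le> qform (fullb d) (subop idop W) v" for v
  proof -
    let ?\<rho> = "outer v"
    have \<rho>: "psdB (fullb d) ?\<rho>" by (rule psdB_outer)
    have \<Phi>\<rho>: "psdB (fullb d) (\<Phi> ?\<rho>)" "Re (trace d (\<Phi> ?\<rho>)) \<le> Re (trace d ?\<rho>)"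
      using \<Phi> \<rho> by (auto simp: qop_def)
    have Wv: "qform (fullb d) W v = trace d (mul d Q (\<Phi> ?\<rho>)) + trace d ?\<rho> - trace d (\<Phi> ?\<rho>)"
      using W unfolding is_wlp_def trace_mul_outer[symmetric] by simp
    have "0 \<le> trace d (mul d Q (\<Phi> ?\<rho>))" "0 \<le> trace d (mul d (subop idop Q) (\<Phi> ?\<rho>))"
      using Q by (auto simp: is_pred_iff intro: trace_mul_psd_nonneg[OF _ \<Phi>\<rho>(1)])
    moreover have "trace d (mul d (subop idop Q) (\<Phi> ?\<rho>)) = trace d (\<Phi> ?\<rho>) - trace d (mul d Q (\<Phi> ?\<rho>))"
      by (simp add: mulB_subop_left trace_subop trace_mul_idop)
    moreover have "qform (fullb d) idop v = trace d ?\<rho>"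
      by (simp add: trace_mul_idop flip: trace_mul_outer)
    moreover have "0 \<le> trace d ?\<rho>" "0 \<le> trace d (\<Phi> ?\<rho>)" using \<rho> \<Phi>\<rho> by (auto intro: trace_psd_nonneg)
    ultimately show ?thesis using \<Phi>\<rho>(2) Wv by (simp add: qform_subop less_eq_complex_def)
  qed
  then show ?thesis by (simp add: is_pred_iff psdB_iff_qform)
qed

text \<open>This turns semantic validity of a triple into the Loewner side condition of a refinement
  rule.\<close>

lemma valid_par_loewner:
  fixes d :: "'v::finite \<Rightarrow> nat"
  assumes "is_pred d P" "is_pred d W" "is_wlp d (sem S d) Q W" "valid_par d P S Q"
  shows "loewner d P W"
  using assms by (intro loewnerI_states) (auto simp: is_pred_iff is_wlp_def valid_par_def)

text \<open>Evaluating the first identity at \<open>sem S d \<rho>\<close> and comparing it with the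
  second cancels all terms in \<open>\<Psi>\<close>, so the triple holds with equality. It supplies
  the body triples of repeat and while.\<close>

lemma valid_par_compose:
  assumes "is_wlp d \<Psi> Q R'" "is_wlp d (\<lambda>\<rho>. \<Psi> (sem S d \<rho>)) Q R"
  shows "valid_par d R S R'"
  using assms by (simp add: is_wlp_def valid_par_def)

lemma qop_id: "qop (d :: 'v::finite \<Rightarrow> nat) (\<lambda>\<rho>. \<rho>)"
  by (simp add: qop_def oplinear_id)

lemma qop_compose: "qop d \<Phi> \<Longrightarrow> qop d \<Psi> \<Longrightarrow> qop d (\<lambda>\<rho>. \<Phi> (\<Psi> \<rho>))"
  unfolding qop_def using oplinear_compose order_trans by blast

lemma qop_funpow: "qop (d :: 'v::finite \<Rightarrow> nat) \<Phi> \<Longrightarrow> qop d (\<Phi> ^^ n)"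
proof (induction n)
  case 0
  then show ?case using qop_id by (simp add: id_def)
next
  case (Suc n)
  then show ?case using qop_compose[of d \<Phi> "\<Phi> ^^ n"] by (simp add: o_def)
qed

subsection \<open>Semantics of the primitive statements\<close>

lemma mulB_sumop_left: "mulB X (sumop Y f) A = sumop Y (\<lambda>y. mulB X (f y) A)"
  by (intro ext) (simp add: mulB_def sumop_def sum_distrib_right sum.swap[of _ X Y])

lemma mulB_sumop_right: "mulB X A (sumop Y f) = sumop Y (\<lambda>y. mulB X A (f y))"
  by (intro ext) (simp add: mulB_def sumop_def sum_distrib_left sum.swap[of _ X Y])

lemma trace_sumop: "trace d (sumop Y f) = (\<Sum>y\<in>Y. trace d (f y))"
  unfolding trace_def sumop_def by (rule sum.swap)

lemma sumlistop_Cons: "sumlistop (A # As) = addop A (sumlistop As)"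
  by (simp add: sumlistop_def)

lemma trace_sumlistop: "trace d (sumlistop As) = (\<Sum>A\<leftarrow>As. trace d A)"
  by (induction As) (simp_all add: sumlistop_Cons trace_addop, simp add: sumlistop_def trace_def zeroop_def)

lemma mulB_sumlistop_left: "mulB X (sumlistop As) B = sumlistop (map (\<lambda>A. mulB X A B) As)"
  by (induction As) (simp_all add: sumlistop_Cons mulB_addop_left, simp add: sumlistop_def mulB_def zeroop_def)

lemma mulB_sumlistop_right: "mulB X B (sumlistop As) = sumlistop (map (mulB X B) As)"
  by (induction As) (simp_all add: sumlistop_Cons mulB_addop_right, simp add: sumlistop_def mulB_def zeroop_def)

lemma trace_init_op:
  fixes d :: "'v::finite \<Rightarrow> nat"
  assumes d: "\<forall>q. 0 < d q"
  shows "trace d (init_op d qs \<rho>) = trace d \<rho>"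
proof -
  \<comment> \<open>Positivity of the dimensions enters here: the product in \<open>kk\<close> sums
    over basis states and is \<open>ketbra x x\<close> because \<open>zeromem\<close> is among
    them.\<close>
  have z: "zeromem \<in> basis d qs" using d by (simp add: basis_def zeromem_def)
  have kk: "eq_on (fullb d) (mul d (lift qs (ketbra x zeromem)) (lift qs (ketbra zeromem x))) (lift qs (ketbra x x))" for x
  proof -
    have "mulB (basis d qs) (ketbra x zeromem) (ketbra zeromem x) = ketbra x x"
    proof (intro ext)
      fix i j
      have "mulB (basis d qs) (ketbra x zeromem) (ketbra zeromem x) i j
          = (\<Sum>k\<in>basis d qs. if k = zeromem then ketbra x x i j else 0)"
        unfolding mulB_def ketbra_def by (intro sum.cong) auto
      then show "mulB (basis d qs) (ketbra x zeromem) (ketbra zeromem x) i j = ketbra x x i j"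
        using z by simp
    qed
    then show ?thesis using mul_lift[of d qs "ketbra x zeromem" "ketbra zeromem x"] by simp
  qed
  have id: "eq_on (fullb d) (sumop (basis d qs) (\<lambda>x. lift qs (ketbra x x))) idop"
  proof (rule eq_onI)
    fix i j assume i: "i \<in> fullb d"
    have "lift qs (ketbra x x) i j = (if x = restr qs i then lift qs idop i j else 0)" for x
      by (auto simp: lift_def ketbra_def idop_def)
    then show "sumop (basis d qs) (\<lambda>x. lift qs (ketbra x x)) i j = idop i j"
      using restr_in_basis[OF i] by (simp add: sumop_def)
  qed
  have "trace d (init_op d qs \<rho>) = (\<Sum>x\<in>basis d qs. trace d (mul d (lift qs (ketbra x x)) \<rho>))"
    unfolding init_op_def trace_sumop
    by (intro sum.cong refl, subst trace_conjugate) (rule trace_cong[OF mulB_cong[OF kk eq_on_refl]])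
  also have "\<dots> = trace d (mul d (sumop (basis d qs) (\<lambda>x. lift qs (ketbra x x))) \<rho>)"
    by (simp add: mulB_sumop_left trace_sumop)
  also have "\<dots> = trace d (mul d idop \<rho>)"
    by (intro trace_cong mulB_cong id) simp
  finally show ?thesis by (simp add: trace_mul_idop)
qed

lemma init_pre_dual: "trace d (mul d (init_pre d qs Q) \<rho>) = trace d (mul d Q (init_op d qs \<rho>))"
  by (simp add: init_pre_def init_op_def mulB_sumop_left mulB_sumop_right trace_sumop trace_conjugate_dual)

lemma adj_ketbra: "adj (ketbra a b) = ketbra b a"
  by (intro ext) (simp add: adj_def ketbra_def)

lemma qop_init_op:
  fixes d :: "'v::finite \<Rightarrow> nat"
  assumes "\<forall>q. 0 < d q"
  shows "qop d (init_op d qs)"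
proof -
  have "oplinear d (init_op d qs)"
    unfolding init_op_def[abs_def] by (intro oplinear_sumop oplinear_conjugate)
  moreover have "psdB (fullb d) (init_op d qs \<rho>)" if "psdB (fullb d) \<rho>" for \<rho>
    unfolding init_op_def
    using psdB_conjugate[OF that, of "lift qs (ketbra zeromem _)", unfolded adj_lift adj_ketbra]
    by (intro psdB_sumop)
  ultimately show ?thesis using trace_init_op[OF assms] by (simp add: qop_def)
qed

lemma trace_unit_op:
  fixes d :: "'v::finite \<Rightarrow> nat"
  assumes "unitary_on d qs U"
  shows "trace d (unit_op d qs U \<rho>) = trace d \<rho>"
proof -
  have "eq_on (fullb d) (mul d (adj (lift qs U)) (lift qs U)) (lift qs (mulB (basis d qs) (adj U) U))"
    unfolding adj_lift by (rule mul_lift)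
  also have "eq_on (fullb d) (lift qs (mulB (basis d qs) (adj U) U)) (lift qs idop)"
    using assms by (intro lift_cong) (simp add: unitary_on_def)
  finally have "trace d (mul d (mul d (adj (lift qs U)) (lift qs U)) \<rho>) = trace d (mul d idop \<rho>)"
    by (intro trace_cong mulB_cong) simp_all
  then show ?thesis by (simp add: unit_op_def trace_conjugate trace_mul_idop)
qed

lemma qop_unit_op:
  fixes d :: "'v::finite \<Rightarrow> nat"
  assumes "unitary_on d qs U"
  shows "qop d (unit_op d qs U)"
  using trace_unit_op[OF assms] oplinear_conjugate[of d] psdB_conjugate[of "fullb d"]
  by (simp add: qop_def unit_op_def[abs_def])

lemma oplinear_meas_op: "oplinear (d :: 'v::finite \<Rightarrow> nat) (meas_op d qs M)"
  unfolding meas_op_def[abs_def] sandwich_def by (rule oplinear_conjugate)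

lemma meas_op_psd:
  fixes d :: "'v::finite \<Rightarrow> nat"
  assumes "psdB (basis d qs) M" "psdB (fullb d) \<rho>"
  shows "psdB (fullb d) (meas_op d qs M \<rho>)"
  unfolding meas_op_def sandwich_def
  by (intro psdB_conjugate_hermitian psdB_adj finite_basis sqrt_op_props lift_psd assms)

text \<open>Cyclicity joins the two roots into the measurement operator itself, so probabilities are
  linear in \<open>M\<close> although the post-measurement operator is not.\<close>

lemma trace_meas_op:
  fixes d :: "'v::finite \<Rightarrow> nat"
  assumes "psdB (basis d qs) M"
  shows "trace d (meas_op d qs M \<rho>) = trace d (mul d (lift qs M) \<rho>)"
  unfolding meas_op_def sandwich_def
  by (subst trace_conjugate) (intro trace_cong mulB_cong sqrt_op_props lift_psd assms eq_on_refl)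

lemma meas_op_dual: "trace d (mul d (meas_op d qs M Q) \<rho>) = trace d (mul d Q (meas_op d qs M \<rho>))"
  by (simp add: meas_op_def sandwich_def trace_conjugate_dual)

lemma trace_measurement:
  fixes d :: "'v::finite \<Rightarrow> nat"
  assumes "measurement_on d qs Ms"
  shows "(\<Sum>M\<leftarrow>Ms. trace d (meas_op d qs M \<rho>)) = trace d \<rho>"
proof -
  have "(\<Sum>M\<leftarrow>Ms. trace d (meas_op d qs M \<rho>)) = (\<Sum>M\<leftarrow>Ms. trace d (mul d (lift qs M) \<rho>))"
    using assms by (intro arg_cong[of _ _ sum_list] map_cong refl trace_meas_op) (simp add: measurement_on_def)
  also have "\<dots> = trace d (mul d (lift qs (sumlistop Ms)) \<rho>)"
    by (simp add: lift_sumlistop mulB_sumlistop_left trace_sumlistop o_def)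
  also have "\<dots> = trace d (mul d (lift qs idop) \<rho>)"
    using assms by (intro trace_cong mulB_cong lift_cong) (simp_all add: measurement_on_def)
  finally show ?thesis by (simp add: trace_mul_idop)
qed

lemma B0_eq_meas_op: "B0 d qs B = meas_op d qs (subop idop B)"
  by (intro ext) (simp add: B0_def meas_op_def)

lemma B1_eq_meas_op: "B1 d qs B = meas_op d qs B"
  by (intro ext) (simp add: B1_def meas_op_def)

lemma binary_on_psd:
  assumes "binary_on d qs B"
  shows "psdB (basis d qs) B" "psdB (basis d qs) (subop idop B)"
  using assms by (simp_all add: binary_on_def loewnerB_def) (simp add: subop_def zeroop_def)

lemma trace_binary:
  fixes d :: "'v::finite \<Rightarrow> nat"
  assumes "binary_on d qs B"
  shows "trace d (B0 d qs B \<rho>) + trace d (B1 d qs B \<rho>) = trace d \<rho>"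
  using binary_on_psd[OF assms]
  by (simp add: B0_eq_meas_op B1_eq_meas_op trace_meas_op lift_subop mulB_subop_left trace_subop trace_mul_idop)

section \<open>Convergence and unrolling of loops\<close>

lemma sums_nonneg_complex:
  fixes f :: "nat \<Rightarrow> complex"
  assumes "f sums s" "\<And>n. 0 \<le> f n"
  shows "0 \<le> s"
proof -
  have f: "0 \<le> Re (f n)" "Im (f n) = 0" for n using assms(2)[of n] by (auto simp: less_eq_complex_def)
  have "0 \<le> Re s" using f(1) by (intro sums_le[OF _ sums_zero sums_Re[OF assms(1)]]) auto
  moreover have "Im s = 0" using sums_Im[OF assms(1)] f(2) sums_unique2[OF _ sums_zero] by simp
  ultimately show ?thesis by (simp add: less_eq_complex_def)
qed

text \<open>Trace that has left the loop and trace still inside never exceed the input trace. This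
  bounds the series on positive operators; linearity extends convergence to all operators, and the
  limit inherits positivity and the trace bound.\<close>

lemma qop_loop:
  fixes d :: "'v::finite \<Rightarrow> nat"
  assumes lin: "oplinear d b0" "oplinear d b1"
    and pos: "\<And>\<rho>. psdB (fullb d) \<rho> \<Longrightarrow> psdB (fullb d) (b0 \<rho>)" "\<And>\<rho>. psdB (fullb d) \<rho> \<Longrightarrow> psdB (fullb d) (b1 \<rho>)"
    and tr: "\<And>\<rho>. trace d (b0 \<rho>) + trace d (b1 \<rho>) = trace d \<rho>"
    and s: "qop d s"
  defines "W \<equiv> \<lambda>\<rho> i j. \<Sum>k. (b0 \<circ> (s \<circ> b1) ^^ k) \<rho> i j"
  shows "qop d W" and "eq_on (fullb d) (W \<rho>) (addop (b0 \<rho>) (W (s (b1 \<rho>))))"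
proof -
  let ?X = "fullb d"
  define Y where "Y k = (s \<circ> b1) ^^ k" for k
  have qb1: "qop d b1"
    unfolding qop_def
  proof (intro conjI allI impI lin pos)
    fix \<rho> assume "psdB ?X \<rho>"
    then have "0 \<le> Re (trace d (b0 \<rho>))" using trace_psd_nonneg[OF pos(1)] by (simp add: less_eq_complex_def)
    then show "Re (trace d (b1 \<rho>)) \<le> Re (trace d \<rho>)" using tr[of \<rho>] by (metis add_increasing plus_complex.sel(1) order_refl)
  qed
  have qY: "qop d (Y k)" for k
    unfolding Y_def using qop_funpow[OF qop_compose[OF s qb1]] by (simp add: o_def)
  have psdb: "psdB ?X (b0 (Y k \<rho>))" if "psdB ?X \<rho>" for k \<rho>
    using qY that by (intro pos) (simp add: qop_def)
  \<comment> \<open>The balance after \<open>n\<close> rounds: the sum is what has exited,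
    \<open>Y n \<rho>\<close> is what remains. Each round splits the remainder exactly by
    \<open>tr\<close>, and the body may only lose trace.\<close>
  have partial: "(\<Sum>k<n. Re (trace d (b0 (Y k \<rho>)))) + Re (trace d (Y n \<rho>)) \<le> Re (trace d \<rho>)"
    if \<rho>: "psdB ?X \<rho>" for n \<rho>
  proof (induction n)
    case 0
    then show ?case by (simp add: Y_def)
  next
    case (Suc n)
    have "psdB ?X (b1 (Y n \<rho>))" using qY[of n] \<rho> by (intro pos) (simp add: qop_def)
    then have "Re (trace d (Y (Suc n) \<rho>)) \<le> Re (trace d (b1 (Y n \<rho>)))"
      using s by (simp add: Y_def qop_def)
    then show ?case using Suc arg_cong[OF tr[of "Y n \<rho>"], of Re] by simp
  qed
  have tr0: "0 \<le> Re (trace d A)" if "psdB ?X A" for A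
    using trace_psd_nonneg[OF that] by (simp add: less_eq_complex_def)
  have bound: "(\<Sum>k<n. Re (trace d (b0 (Y k \<rho>)))) \<le> Re (trace d \<rho>)" if \<rho>: "psdB ?X \<rho>" for n \<rho>
    using partial[OF \<rho>, of n] tr0[of "Y n \<rho>"] qY[of n] \<rho> by (simp add: qop_def)
  have smt: "summable (\<lambda>k. Re (trace d (b0 (Y k \<rho>))))" if \<rho>: "psdB ?X \<rho>" for \<rho>
    by (rule summableI_nonneg_bounded[OF tr0[OF psdb[OF \<rho>]] bound[OF \<rho>]])
  have lf: "linfun d (\<lambda>\<rho>. b0 (Y k \<rho>) i j)" if "i \<in> ?X" "j \<in> ?X" for i j k
    using oplinear_compose[OF lin(1), of "Y k"] qY[of k] that by (simp add: qop_def oplinear_def)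
  have sm: "summable (\<lambda>k. b0 (Y k \<rho>) i j)" if ij: "i \<in> ?X" "j \<in> ?X" for i j \<rho>
  proof (rule linfun_summable[OF lf[OF ij]])
    fix \<rho> assume \<rho>: "psdB ?X \<rho>"
    show "summable (\<lambda>k. b0 (Y k \<rho>) i j)"
      using psd_trace_bound[OF psdb[OF \<rho>] ij] by (rule summable_comparison_test'[OF smt[OF \<rho>]])
  qed
  have W: "W \<rho> i j = (\<Sum>k. b0 (Y k \<rho>) i j)" for \<rho> i j by (simp add: W_def Y_def)
  have sums: "(\<lambda>k. b0 (Y k \<rho>) i j) sums W \<rho> i j" if "i \<in> ?X" "j \<in> ?X" for i j \<rho>
    unfolding W using sm[OF that] by (rule summable_sums)
  have "oplinear d W"
    unfolding oplinear_def W by (intro ballI linfun_suminf lf sm)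
  moreover have "psdB ?X (W \<rho>)" if \<rho>: "psdB ?X \<rho>" for \<rho>
  proof (rule psdBI)
    fix v
    have "(\<lambda>k. qform ?X (b0 (Y k \<rho>)) v) sums qform ?X (W \<rho>) v"
      unfolding qform_def by (intro sums_sum sums_mult sums_mult2 sums)
    then show "0 \<le> qform ?X (W \<rho>) v" by (rule sums_nonneg_complex) (rule psdBD[OF psdb[OF \<rho>]])
  qed
  moreover have "Re (trace d (W \<rho>)) \<le> Re (trace d \<rho>)" if \<rho>: "psdB ?X \<rho>" for \<rho>
  proof -
    have "(\<lambda>k. trace d (b0 (Y k \<rho>))) sums trace d (W \<rho>)"
      unfolding trace_def by (intro sums_sum sums)
    then have "(\<lambda>k. Re (trace d (b0 (Y k \<rho>)))) sums Re (trace d (W \<rho>))" by (rule sums_Re)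
    then have "Re (trace d (W \<rho>)) = (\<Sum>k. Re (trace d (b0 (Y k \<rho>))))" by (simp add: sums_iff)
    also have "\<dots> \<le> Re (trace d \<rho>)" by (rule suminf_le_const[OF smt[OF \<rho>] bound[OF \<rho>]])
    finally show ?thesis .
  qed
  ultimately show "qop d W" by (simp add: qop_def)
  show "eq_on ?X (W \<rho>) (addop (b0 \<rho>) (W (s (b1 \<rho>))))"
  proof (rule eq_onI)
    fix i j assume ij: "i \<in> ?X" "j \<in> ?X"
    \<comment> \<open>The first round, not the last, is split off the iterate, so that the tail of
      the series is the loop started after one round.\<close>
    have "Y (Suc k) \<rho> = Y k (s (b1 \<rho>))" for k
      by (simp add: Y_def funpow_Suc_right del: funpow.simps)
    then have "W \<rho> i j = b0 (Y 0 \<rho>) i j + (\<Sum>k. b0 (Y k (s (b1 \<rho>))) i j)"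
      unfolding W using suminf_split_head[OF sm[OF ij, of \<rho>]] by simp
    then show "W \<rho> i j = addop (b0 \<rho>) (W (s (b1 \<rho>))) i j"
      by (simp add: addop_def W) (simp add: Y_def)
  qed
qed

subsection \<open>Semantics of concrete programs\<close>

lemma sem_while_props:
  fixes d :: "'v::finite \<Rightarrow> nat"
  assumes B: "binary_on d qs B" and S: "qop d (sem S d)"
  shows "qop d (sem (While qs B S) d)"
    and "eq_on (fullb d) (sem (While qs B S) d \<rho>)
      (addop (B0 d qs B \<rho>) (sem (While qs B S) d (sem S d (B1 d qs B \<rho>))))"
proof -
  have sem: "sem (While qs B S) d = (\<lambda>\<rho> i j. \<Sum>k. (B0 d qs B \<circ> (sem S d \<circ> B1 d qs B) ^^ k) \<rho> i j)"
    by (intro ext) simp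
  have lin: "oplinear d (B0 d qs B)" "oplinear d (B1 d qs B)"
    unfolding B0_eq_meas_op B1_eq_meas_op by (rule oplinear_meas_op)+
  have pos: "psdB (fullb d) (B0 d qs B \<rho>)" "psdB (fullb d) (B1 d qs B \<rho>)" if "psdB (fullb d) \<rho>" for \<rho>
    unfolding B0_eq_meas_op B1_eq_meas_op by (intro meas_op_psd binary_on_psd[OF B] that)+
  note loop = qop_loop[OF lin pos trace_binary[OF B] S]
  show "qop d (sem (While qs B S) d)" unfolding sem by (rule loop(1))
  show "eq_on (fullb d) (sem (While qs B S) d \<rho>)
      (addop (B0 d qs B \<rho>) (sem (While qs B S) d (sem S d (B1 d qs B \<rho>))))"
    unfolding sem by (rule loop(2))
qed

text \<open>Each branch can only lose trace from its measured part, and by completeness of the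
  measurement these parts have total trace equal to that of the input.\<close>

lemma qop_case:
  fixes d :: "'v::finite \<Rightarrow> nat"
  assumes M: "measurement_on d qs (map fst cs)" and S: "\<And>c. c \<in> set cs \<Longrightarrow> qop d (sem (snd c) d)"
  shows "qop d (sem (Case qs cs) d)"
proof -
  have sem: "sem (Case qs cs) d = (\<lambda>\<rho>. sumlistop (map (\<lambda>c. sem (snd c) d (meas_op d qs (fst c) \<rho>)) cs))"
    by (intro ext) simp
  have "oplinear d (sem (Case qs cs) d)"
    unfolding sem using S
    by (intro oplinear_sumlistop) (rule oplinear_compose[OF _ oplinear_meas_op], simp add: qop_def)
  moreover {
    fix \<rho> assume \<rho>: "psdB (fullb d) \<rho>"
    have pm: "psdB (fullb d) (meas_op d qs (fst c) \<rho>)" if "c \<in> set cs" for c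
      using M that by (intro meas_op_psd \<rho>) (auto simp: measurement_on_def)
    have "psdB (fullb d) (sem (Case qs cs) d \<rho>)"
    proof -
      have "psdB (fullb d) (sem (snd c) d (meas_op d qs (fst c) \<rho>))" if "c \<in> set cs" for c
        using S[OF that] pm[OF that] by (simp add: qop_def)
      then show ?thesis unfolding sem by (intro psdB_sumlistop) auto
    qed
    moreover have "Re (trace d (sem (Case qs cs) d \<rho>)) \<le> Re (trace d \<rho>)"
    proof -
      have Re_sum_list: "Re (sum_list zs) = sum_list (map Re zs)" for zs by (induction zs) auto
      have "Re (trace d (sem (Case qs cs) d \<rho>)) = (\<Sum>c\<leftarrow>cs. Re (trace d (sem (snd c) d (meas_op d qs (fst c) \<rho>))))"
        unfolding sem by (simp add: trace_sumlistop Re_sum_list o_def)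
      also have "\<dots> \<le> (\<Sum>c\<leftarrow>cs. Re (trace d (meas_op d qs (fst c) \<rho>)))"
      proof (rule sum_list_mono)
        fix c assume "c \<in> set cs"
        then show "Re (trace d (sem (snd c) d (meas_op d qs (fst c) \<rho>))) \<le> Re (trace d (meas_op d qs (fst c) \<rho>))"
          using S[of c] pm[of c] by (simp add: qop_def)
      qed
      also have "\<dots> = Re (trace d \<rho>)"
        using arg_cong[OF trace_measurement[OF M, of \<rho>], of Re] by (simp add: Re_sum_list o_def)
      finally show ?thesis .
    qed
    ultimately have "psdB (fullb d) (sem (Case qs cs) d \<rho>) \<and> Re (trace d (sem (Case qs cs) d \<rho>)) \<le> Re (trace d \<rho>)" ..
  }
  ultimately show ?thesis unfolding qop_def by blast
qed

lemma qop_sem: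
  fixes d :: "'v::finite \<Rightarrow> nat"
  assumes d: "\<forall>q. 0 < d q"
  shows "concrete S \<Longrightarrow> wf_prog d S \<Longrightarrow> qop d (sem S d)"
proof (induction S)
  case Skip
  have "sem Skip d = (\<lambda>\<rho>. \<rho>)" by (intro ext) simp
  then show ?case by (simp add: qop_id)
next
  case (Init qs)
  have "sem (Init qs) d = init_op d qs" by (intro ext) simp
  then show ?case by (simp add: qop_init_op[OF d])
next
  case (Unit qs U)
  have "sem (Unit qs U) d = unit_op d qs U" by (intro ext) simp
  then show ?case using Unit by (simp add: qop_unit_op)
next
  case (Seq S1 S2)
  have "sem (Seq S1 S2) d = (\<lambda>\<rho>. sem S2 d (sem S1 d \<rho>))" by (intro ext) simp
  then show ?case using Seq by (simp add: qop_compose)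
next
  case (Repeat N S)
  have "sem (Repeat N S) d = sem S d ^^ N" by (intro ext) simp
  then show ?case using Repeat by (simp add: qop_funpow)
next
  case (Case qs cs)
  have "qop d (sem (snd c) d)" if "c \<in> set cs" for c
    using Case.prems that by (intro Case.IH[OF that snds.intros]) simp_all
  then show ?case using Case.prems by (intro qop_case) simp_all
next
  case (While qs B S)
  then show ?case by (intro sem_while_props) simp_all
qed simp

text \<open>The identity fixes \<open>W\<close> only on entries indexed by the basis, hence the
  choice of a representative.\<close>

definition wlp :: "('v \<Rightarrow> nat) \<Rightarrow> 'v prog \<Rightarrow> 'v op \<Rightarrow> 'v op" where
  "wlp d S Q = (SOME W. is_wlp d (sem S d) Q W)"

lemma wlp_props:
  fixes d :: "'v::finite \<Rightarrow> nat"
  assumes "qop d (sem S d)"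
  shows "is_wlp d (sem S d) Q (wlp d S Q)" "is_pred d Q \<Longrightarrow> is_pred d (wlp d S Q)"
proof -
  have "\<exists>W. is_wlp d (sem S d) Q W"
    using assms by (intro is_wlp_exists) (simp add: qop_def)
  then show wlp: "is_wlp d (sem S d) Q (wlp d S Q)" unfolding wlp_def by (rule someI_ex)
  show "is_pred d Q \<Longrightarrow> is_pred d (wlp d S Q)" using is_wlp_pred[OF assms _ wlp] .
qed

lemma valid_par_wlp:
  fixes d :: "'v::finite \<Rightarrow> nat"
  assumes "qop d (sem S d)"
  shows "valid_par d (wlp d S Q) S Q"
  using wlp_props(1)[OF assms, of Q] by (simp add: is_wlp_def valid_par_def)

lemma valid_par_le_wlp:
  fixes d :: "'v::finite \<Rightarrow> nat"
  assumes "qop d (sem S d)" "is_pred d P" "is_pred d Q" "valid_par d P S Q"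
  shows "loewner d P (wlp d S Q)"
  using valid_par_loewner[OF assms(2) wlp_props(2)[OF assms(1,3)] wlp_props(1)[OF assms(1)] assms(4)] .

text \<open>The wlp of a loop is the fixed point of its unrolling, with invariant the wlp of
  one body execution followed by the loop.\<close>

lemma is_wlp_while:
  fixes d :: "'v::finite \<Rightarrow> nat"
  assumes B: "binary_on d qs B" and S: "qop d (sem S d)"
    and R: "is_wlp d (\<lambda>\<rho>. sem (While qs B S) d (sem S d \<rho>)) Q R"
  shows "is_wlp d (sem (While qs B S) d) Q (addop (B0 d qs B Q) (B1 d qs B R))"
  unfolding is_wlp_def
proof (rule allI)
  fix \<rho>
  let ?W = "sem (While qs B S) d" and ?b0 = "B0 d qs B" and ?b1 = "B1 d qs B"
  let ?\<sigma> = "?W (sem S d (?b1 \<rho>))"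
  note unroll = sem_while_props(2)[OF B S, of \<rho>]
  have "trace d (?W \<rho>) = trace d (?b0 \<rho>) + trace d ?\<sigma>"
    using trace_cong[OF unroll] by (simp only: trace_addop)
  moreover have "trace d (mul d Q (?W \<rho>)) = trace d (mul d Q (?b0 \<rho>)) + trace d (mul d Q ?\<sigma>)"
    using trace_cong[OF mulB_cong[OF eq_on_refl[of _ Q] unroll]] by (simp only: mulB_addop_right trace_addop)
  moreover have "trace d (mul d (addop (?b0 Q) (?b1 R)) \<rho>) = trace d (mul d Q (?b0 \<rho>)) + trace d (mul d R (?b1 \<rho>))"
    by (simp add: mulB_addop_left trace_addop B0_eq_meas_op B1_eq_meas_op meas_op_dual)
  moreover have "trace d (mul d R (?b1 \<rho>)) = trace d (mul d Q ?\<sigma>) + trace d (?b1 \<rho>) - trace d ?\<sigma>"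
    using R unfolding is_wlp_def by blast
  ultimately show "trace d (mul d (addop (?b0 Q) (?b1 R)) \<rho>)
      = trace d (mul d Q (?W \<rho>)) + trace d \<rho> - trace d (?W \<rho>)"
    unfolding trace_binary[OF B, of \<rho>, symmetric] by algebra
qed

text \<open>Measurement maps are self-dual under the trace, so each branch contributes its own
  identity at the measured state; completeness reassembles the middle terms into the trace of
  \<open>\<rho>\<close>.\<close>

lemma is_wlp_case:
  fixes d :: "'v::finite \<Rightarrow> nat"
  assumes M: "measurement_on d qs (map fst cs)"
    and W: "\<And>c. c \<in> set cs \<Longrightarrow> is_wlp d (sem (snd c) d) Q (W c)"
  shows "is_wlp d (sem (Case qs cs) d) Q (sumlistop (map (\<lambda>c. meas_op d qs (fst c) (W c)) cs))"
  unfolding is_wlp_def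
proof (rule allI)
  fix \<rho>
  let ?m = "\<lambda>c. meas_op d qs (fst c) \<rho>"
  have "trace d (mul d (sumlistop (map (\<lambda>c. meas_op d qs (fst c) (W c)) cs)) \<rho>)
      = (\<Sum>c\<leftarrow>cs. trace d (mul d (W c) (?m c)))"
    by (simp add: mulB_sumlistop_left trace_sumlistop o_def meas_op_dual)
  also have "\<dots> = (\<Sum>c\<leftarrow>cs. trace d (mul d Q (sem (snd c) d (?m c))) + trace d (?m c) - trace d (sem (snd c) d (?m c)))"
    using W by (intro arg_cong[of _ _ sum_list] map_cong) (simp_all add: is_wlp_def)
  also have "\<dots> = (\<Sum>c\<leftarrow>cs. trace d (mul d Q (sem (snd c) d (?m c)))) + (\<Sum>c\<leftarrow>cs. trace d (?m c))
      - (\<Sum>c\<leftarrow>cs. trace d (sem (snd c) d (?m c)))"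
    by (simp add: sum_list_addf sum_list_subtractf)
  also have "(\<Sum>c\<leftarrow>cs. trace d (?m c)) = trace d \<rho>"
    using trace_measurement[OF M, of \<rho>] by (simp add: o_def)
  finally show "trace d (mul d (sumlistop (map (\<lambda>c. meas_op d qs (fst c) (W c)) cs)) \<rho>)
      = trace d (mul d Q (sem (Case qs cs) d \<rho>)) + trace d \<rho> - trace d (sem (Case qs cs) d \<rho>)"
    by (simp add: mulB_sumlistop_right trace_sumlistop o_def)
qed

subsection \<open>Refining families of holes\<close>

text \<open>Choosing one rule instance per specification suffices below, so the relation demanded by
  \<open>hole_step\<close> is taken to be the graph of \<open>t\<close>.\<close>

lemma hole_step_family:
  assumes "rule_shape T" "wf_prog d T"
    and "\<And>s. s \<in> F \<Longrightarrow> hole_inst d s (t s) \<and> shape (t s) = shape T"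
    and "\<And>k. k < length (holes T) \<Longrightarrow> holes T ! k = (\<Union>s\<in>F. holes (t s) ! k)"
  shows "refine_par d (Hole F) T"
proof (rule refine_par.hole)
  let ?I = "(\<lambda>s. (s, t s)) ` F"
  have "\<forall>(s, t')\<in>?I. s \<in> F \<and> hole_inst d s t' \<and> shape t' = shape T"
    using assms(3) by simp
  moreover have "\<forall>s\<in>F. \<exists>t'. (s, t') \<in> ?I" by blast
  moreover have "\<forall>k<length (holes T). holes T ! k = (\<Union>(s, t')\<in>?I. holes t' ! k)"
    using assms(4) by simp
  ultimately show "hole_step d F T"
    unfolding hole_step_def using assms(1,2) by (intro conjI exI[of _ ?I])
qed

lemma refine_seqL: "(refine_par d)\<^sup>*\<^sup>* S S' \<Longrightarrow> (refine_par d)\<^sup>*\<^sup>* (Seq S R) (Seq S' R)"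
  by (induction rule: rtranclp_induct) (simp, erule rtranclp.rtrancl_into_rtrancl, erule refine_par.seqL)

lemma refine_seqR: "(refine_par d)\<^sup>*\<^sup>* R R' \<Longrightarrow> (refine_par d)\<^sup>*\<^sup>* (Seq S R) (Seq S R')"
  by (induction rule: rtranclp_induct) (simp, erule rtranclp.rtrancl_into_rtrancl, erule refine_par.seqR)

lemma refine_repeat: "(refine_par d)\<^sup>*\<^sup>* S S' \<Longrightarrow> (refine_par d)\<^sup>*\<^sup>* (Repeat N S) (Repeat N S')"
  by (induction rule: rtranclp_induct) (simp, erule rtranclp.rtrancl_into_rtrancl, erule refine_par.repeat)

lemma refine_while: "(refine_par d)\<^sup>*\<^sup>* S S' \<Longrightarrow> (refine_par d)\<^sup>*\<^sup>* (While qs B S) (While qs B S')"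
  by (induction rule: rtranclp_induct) (simp, erule rtranclp.rtrancl_into_rtrancl, erule refine_par.while)

lemma refine_case_branch: "(refine_par d)\<^sup>*\<^sup>* S S' \<Longrightarrow>
    (refine_par d)\<^sup>*\<^sup>* (Case qs (cs1 @ (M, S) # cs2)) (Case qs (cs1 @ (M, S') # cs2))"
  by (induction rule: rtranclp_induct) (simp, erule rtranclp.rtrancl_into_rtrancl, erule refine_par.case_)

text \<open>Branches are refined from left to right, one at a time; \<open>pre\<close> holds those
  already finished.\<close>

lemma refine_case_branches:
  assumes "\<And>c. c \<in> set cs \<Longrightarrow> (refine_par d)\<^sup>*\<^sup>* (f c) (snd c)"
  shows "(refine_par d)\<^sup>*\<^sup>* (Case qs (pre @ map (\<lambda>c. (fst c, f c)) cs)) (Case qs (pre @ cs))"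
  using assms
proof (induction cs arbitrary: pre)
  case (Cons c cs)
  have "(refine_par d)\<^sup>*\<^sup>* (Case qs (pre @ (fst c, f c) # map (\<lambda>c. (fst c, f c)) cs))
      (Case qs (pre @ (fst c, snd c) # map (\<lambda>c. (fst c, f c)) cs))"
    by (rule refine_case_branch) (simp add: Cons.prems)
  also have "(refine_par d)\<^sup>*\<^sup>* \<dots> (Case qs (pre @ c # cs))"
    using Cons.IH[of "pre @ [c]"] Cons.prems by simp
  finally show ?case by simp
qed simp

definition valid_family :: "('v \<Rightarrow> nat) \<Rightarrow> ('v op \<times> 'v op) set \<Rightarrow> 'v prog \<Rightarrow> bool" where
  "valid_family d F S \<longleftrightarrow> (\<forall>(P, Q)\<in>F. is_pred d P \<and> is_pred d Q \<and> valid_par d P S Q)"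

lemma refine_family:
  fixes d :: "'v::finite \<Rightarrow> nat"
  assumes d: "\<forall>q. 0 < d q"
  shows "concrete S \<Longrightarrow> wf_prog d S \<Longrightarrow> valid_family d F S \<Longrightarrow> (refine_par d)\<^sup>*\<^sup>* (Hole F) S"
proof (induction S arbitrary: F)
  case Skip
  \<comment> \<open>\<open>Q\<close> is its own weakest liberal precondition under
    \<open>Skip\<close>.\<close>
  have "loewner d P Q" if "(P, Q) \<in> F" for P Q
    using Skip.prems(3) that
    by (intro valid_par_loewner[of d P Q Skip Q]) (auto simp: valid_family_def is_wlp_def)
  then have "refine_par d (Hole F) Skip"
    by (intro hole_step_family[where t = "\<lambda>_. Skip"]) (auto intro: hole_inst.H_skip)
  then show ?case by blast
next
  case (Init qs)
  \<comment> \<open>Initialisation preserves the trace, so the two trace terms cancel and the dual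
    map alone gives the precondition; unitary statements behave alike.\<close>
  have wlp: "is_wlp d (sem (Init qs) d) Q (init_pre d qs Q)" for Q
    by (simp add: is_wlp_def init_pre_dual trace_init_op[OF d])
  have "loewner d P (init_pre d qs Q)" if "(P, Q) \<in> F" for P Q
  proof -
    have PQ: "is_pred d P" "is_pred d Q" "valid_par d P (Init qs) Q"
      using Init.prems(3) that by (auto simp: valid_family_def)
    show ?thesis
      by (rule valid_par_loewner[OF PQ(1) is_wlp_pred[OF qop_sem[OF d Init.prems(1,2)] PQ(2) wlp] wlp PQ(3)])
  qed
  then have "refine_par d (Hole F) (Init qs)"
    by (intro hole_step_family[where t = "\<lambda>_. Init qs"]) (auto intro: hole_inst.H_init)
  then show ?case by blast
next
  case (Unit qs U)
  have U: "unitary_on d qs U" using Unit by simp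
  have wlp: "is_wlp d (sem (Unit qs U) d) Q (mul d (mul d (adj (lift qs U)) Q) (lift qs U))" for Q
    by (simp add: is_wlp_def trace_conjugate_dual trace_unit_op[OF U]) (simp add: unit_op_def)
  have "loewner d P (mul d (mul d (adj (lift qs U)) Q) (lift qs U))" if "(P, Q) \<in> F" for P Q
  proof -
    have PQ: "is_pred d P" "is_pred d Q" "valid_par d P (Unit qs U) Q"
      using Unit.prems(3) that by (auto simp: valid_family_def)
    show ?thesis
      by (rule valid_par_loewner[OF PQ(1) is_wlp_pred[OF qop_sem[OF d Unit.prems(1,2)] PQ(2) wlp] wlp PQ(3)])
  qed
  then have "refine_par d (Hole F) (Unit qs U)"
    using U by (intro hole_step_family[where t = "\<lambda>_. Unit qs U"]) (auto intro: hole_inst.H_unit)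
  then show ?case by blast
next
  case (Seq S1 S2)
  have q1: "qop d (sem S1 d)" and q2: "qop d (sem S2 d)" using Seq.prems qop_sem[OF d] by auto
  let ?R = "wlp d S2"
  let ?F1 = "\<Union>(P, Q)\<in>F. {(P, ?R Q)}" and ?F2 = "\<Union>(P, Q)\<in>F. {(?R Q, Q)}"
  have pred: "is_pred d (?R Q)" if "(P, Q) \<in> F" for P Q
    using Seq.prems(3) that wlp_props(2)[OF q2] by (auto simp: valid_family_def)
  \<comment> \<open>In the bound for the sequence, the intermediate predicate absorbs the
    contribution of \<open>S2\<close>, leaving the bound for \<open>S1\<close> alone.\<close>
  have v1: "valid_par d P S1 (?R Q)" if "(P, Q) \<in> F" for P Q
  proof -
    have "valid_par d P (Seq S1 S2) Q" using Seq.prems(3) that by (auto simp: valid_family_def)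
    then show ?thesis using wlp_props(1)[OF q2, of Q] by (simp add: valid_par_def is_wlp_def add_diff_eq)
  qed
  have "refine_par d (Hole F) (Seq (Hole ?F1) (Hole ?F2))"
  proof (rule hole_step_family[where t = "\<lambda>(P, Q). Seq (Hole {(P, ?R Q)}) (Hole {(?R Q, Q)})"])
    fix s assume "s \<in> F"
    then show "hole_inst d s (case s of (P, Q) \<Rightarrow> Seq (Hole {(P, ?R Q)}) (Hole {(?R Q, Q)})) \<and>
        shape (case s of (P, Q) \<Rightarrow> Seq (Hole {(P, ?R Q)}) (Hole {(?R Q, Q)})) = shape (Seq (Hole ?F1) (Hole ?F2))"
      using pred by (cases s) (auto intro: hole_inst.H_seq)
  next
    fix k assume "k < length (holes (Seq (Hole ?F1) (Hole ?F2)))"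
    then have "k = 0 \<or> k = 1" by auto
    then show "holes (Seq (Hole ?F1) (Hole ?F2)) ! k =
        (\<Union>s\<in>F. holes (case s of (P, Q) \<Rightarrow> Seq (Hole {(P, ?R Q)}) (Hole {(?R Q, Q)})) ! k)"
      by (elim disjE) (simp_all add: split_beta)
  qed simp_all
  also have "(refine_par d)\<^sup>*\<^sup>* (Seq (Hole ?F1) (Hole ?F2)) (Seq S1 (Hole ?F2))"
    using Seq.prems pred v1 by (intro refine_seqL Seq.IH(1)) (auto simp: valid_family_def)
  also have "(refine_par d)\<^sup>*\<^sup>* (Seq S1 (Hole ?F2)) (Seq S1 S2)"
    using Seq.prems pred valid_par_wlp[OF q2] by (intro refine_seqR Seq.IH(2)) (auto simp: valid_family_def)
  finally show ?case .
next
  case (Repeat N S)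
  have q: "qop d (sem (Repeat n S) d)" for n using Repeat.prems by (intro qop_sem[OF d]) auto
  \<comment> \<open>\<open>R Q j\<close> accounts for the \<open>N - j\<close> rounds still to come,
    so index \<open>0\<close> belongs to the whole loop and index \<open>N\<close> to no round at
    all.\<close>
  define R where "R Q j = wlp d (Repeat (N - j) S) Q" for Q j
  have pred: "is_pred d (R Q j)" if "(P, Q) \<in> F" for P Q j
    using Repeat.prems(3) that wlp_props(2)[OF q] by (auto simp: valid_family_def R_def)
  let ?F = "\<Union>(P, Q)\<in>F. {(R Q j, R Q (Suc j)) | j. j < N}"
  have step: "valid_par d (R Q j) S (R Q (Suc j))" if "j < N" for Q j
  proof (rule valid_par_compose)
    show "is_wlp d (sem (Repeat (N - Suc j) S) d) Q (R Q (Suc j))"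
      unfolding R_def by (rule wlp_props(1)[OF q])
    \<comment> \<open>The first of the remaining rounds is the body execution under consideration;
      \<open>j < N\<close> ensures that there is one.\<close>
    have "(\<lambda>\<rho>. sem (Repeat (N - Suc j) S) d (sem S d \<rho>)) = sem (Repeat (N - j) S) d"
      using that by (intro ext) (simp add: Suc_diff_Suc[symmetric] funpow_swap1)
    then show "is_wlp d (\<lambda>\<rho>. sem (Repeat (N - Suc j) S) d (sem S d \<rho>)) Q (R Q j)"
      using wlp_props(1)[OF q, of "N - j" Q] by (simp add: R_def)
  qed
  have "refine_par d (Hole F) (Repeat N (Hole ?F))"
  proof (rule hole_step_family[where t = "\<lambda>(P, Q). Repeat N (Hole {(R Q j, R Q (Suc j)) | j. j < N})"])
    fix s assume s: "s \<in> F"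
    obtain P Q where PQ: "s = (P, Q)" by (cases s)
    have pv: "is_pred d P" "is_pred d Q" "valid_par d P (Repeat N S) Q"
      using Repeat.prems(3) s PQ by (auto simp: valid_family_def)
    have "hole_inst d (P, Q) (Repeat N (Hole {(R Q j, R Q (Suc j)) | j. j < N}))"
    proof (rule hole_inst.H_repeat)
      show "\<forall>j\<le>N. is_pred d (R Q j)" using pred s PQ by blast
      show "loewner d P (R Q 0)" using valid_par_le_wlp[OF q pv] by (simp add: R_def)
      \<comment> \<open>For zero rounds the chosen matrix has the same traces as \<open>Q\<close>,
        which gives the order relation even if the functions differ outside the basis.\<close>
      show "loewner d (R Q N) Q"
        using pred[of P Q N] s PQ pv(2) wlp_props(1)[OF q, of 0 Q]
        by (intro loewnerI_states) (simp_all add: is_pred_iff is_wlp_def R_def)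
    qed
    then show "hole_inst d s (case s of (P, Q) \<Rightarrow> Repeat N (Hole {(R Q j, R Q (Suc j)) | j. j < N})) \<and>
        shape (case s of (P, Q) \<Rightarrow> Repeat N (Hole {(R Q j, R Q (Suc j)) | j. j < N})) = shape (Repeat N (Hole ?F))"
      by (simp add: PQ)
  qed (use Repeat.prems in \<open>simp_all add: split_beta\<close>)
  also have "(refine_par d)\<^sup>*\<^sup>* (Repeat N (Hole ?F)) (Repeat N S)"
    using Repeat.prems pred step by (intro refine_repeat Repeat.IH) (auto simp: valid_family_def)
  finally show ?case .
next
  case (Case qs cs)
  have M: "measurement_on d qs (map fst cs)" using Case.prems by simp
  have q: "qop d (sem (snd c) d)" if "c \<in> set cs" for c
    using Case.prems that by (intro qop_sem[OF d]) auto
  let ?W = "\<lambda>Q c. wlp d (snd c) Q"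
  let ?F = "\<lambda>c. \<Union>(P, Q)\<in>F. {(?W Q c, Q)}"
  let ?t = "\<lambda>(P, Q). Case qs (map (\<lambda>c. (fst c, Hole {(?W Q c, Q)})) cs)"
  have pred: "is_pred d (?W Q c)" if "(P, Q) \<in> F" "c \<in> set cs" for P Q c
    using Case.prems(3) that(1) wlp_props(2)[OF q[OF that(2)]] by (auto simp: valid_family_def)
  have holes: "concat (map (\<lambda>c. [g c]) cs) = map g cs" for g :: "_ \<Rightarrow> ('v op \<times> 'v op) set"
    by (induction cs) auto
  have "refine_par d (Hole F) (Case qs (map (\<lambda>c. (fst c, Hole (?F c))) cs))"
  proof (rule hole_step_family[where t = ?t])
    fix s assume s: "s \<in> F"
    obtain P Q where PQ: "s = (P, Q)" by (cases s)
    have pv: "is_pred d P" "is_pred d Q" "valid_par d P (Case qs cs) Q"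
      using Case.prems(3) s PQ by (auto simp: valid_family_def)
    have wlp: "is_wlp d (sem (Case qs cs) d) Q (sumlistop (map (\<lambda>c. meas_op d qs (fst c) (?W Q c)) cs))"
      by (rule is_wlp_case[OF M wlp_props(1)[OF q]])
    have "hole_inst d (P, Q) (Case qs (map2 (\<lambda>M P'. (M, Hole {(P', Q)})) (map fst cs) (map (?W Q) cs)))"
    proof (rule hole_inst.H_case[OF M])
      show "\<forall>P'\<in>set (map (?W Q) cs). is_pred d P'" using pred s PQ by auto
      show "loewner d P (sumlistop (map2 (\<lambda>M P'. meas_op d qs M P') (map fst cs) (map (?W Q) cs)))"
        using valid_par_loewner[OF pv(1) is_wlp_pred[OF qop_case[OF M q] pv(2) wlp] wlp pv(3)]
        by (simp add: zip_map_map zip_same_conv_map o_def)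
    qed simp
    then show "hole_inst d s (?t s) \<and> shape (?t s) = shape (Case qs (map (\<lambda>c. (fst c, Hole (?F c))) cs))"
      by (simp add: PQ zip_map_map zip_same_conv_map o_def)
  next
    fix k assume "k < length (holes (Case qs (map (\<lambda>c. (fst c, Hole (?F c))) cs)))"
    then show "holes (Case qs (map (\<lambda>c. (fst c, Hole (?F c))) cs)) ! k = (\<Union>s\<in>F. holes (?t s) ! k)"
      by (simp add: o_def holes split_beta)
  qed (use M in \<open>auto simp: o_def\<close>)
  also have "(refine_par d)\<^sup>*\<^sup>* (Case qs (map (\<lambda>c. (fst c, Hole (?F c))) cs)) (Case qs cs)"
  proof (rule refine_case_branches[where pre = "[]", simplified])
    fix c assume c: "c \<in> set cs"
    have "valid_family d (?F c) (snd c)"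
      using Case.prems(3) pred[OF _ c] valid_par_wlp[OF q[OF c]] by (auto simp: valid_family_def)
    then show "(refine_par d)\<^sup>*\<^sup>* (Hole (?F c)) (snd c)"
      using Case.prems c by (intro Case.IH[OF c snds.intros]) simp_all
  qed
  finally show ?case .
next
  case (While qs B S)
  let ?W = "While qs B S"
  have B: "binary_on d qs B" and q: "qop d (sem S d)" and qW: "qop d (sem ?W d)"
    and qSW: "qop d (sem (Seq S ?W) d)"
    using While.prems by (auto intro!: qop_sem[OF d])
  \<comment> \<open>The invariant describes the state on entry to the body: one body execution, then
    the loop again. The postcondition \<open>?I Q\<close> of the body is then the precondition of
    the loop itself.\<close>
  let ?R = "wlp d (Seq S ?W)"
  let ?I = "\<lambda>Q. addop (B0 d qs B Q) (B1 d qs B (?R Q))"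
  have wlpR: "is_wlp d (\<lambda>\<rho>. sem ?W d (sem S d \<rho>)) Q (?R Q)" for Q
    using wlp_props(1)[OF qSW, of Q] unfolding is_wlp_def sem.simps(4) .
  have wlpI: "is_wlp d (sem ?W d) Q (?I Q)" for Q by (rule is_wlp_while[OF B q wlpR])
  have pred: "is_pred d (?R Q)" "is_pred d (?I Q)" if "(P, Q) \<in> F" for P Q
  proof -
    have "is_pred d Q" using While.prems(3) that by (auto simp: valid_family_def)
    then show "is_pred d (?R Q)" "is_pred d (?I Q)"
      using wlp_props(2)[OF qSW] is_wlp_pred[OF qW _ wlpI] by blast+
  qed
  let ?F = "\<Union>(P, Q)\<in>F. {(?R Q, ?I Q)}"
  let ?t = "\<lambda>(P, Q). While qs B (Hole {(?R Q, ?I Q)})"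
  have "refine_par d (Hole F) (While qs B (Hole ?F))"
  proof (rule hole_step_family[where t = ?t])
    fix s assume s: "s \<in> F"
    obtain P Q where PQ: "s = (P, Q)" by (cases s)
    have pv: "is_pred d P" "valid_par d P ?W Q"
      using While.prems(3) s PQ by (auto simp: valid_family_def)
    have "hole_inst d (P, Q) (While qs B (Hole {(?R Q, ?I Q)}))"
      using s PQ by (intro hole_inst.HP_while B valid_par_loewner[OF pv(1) _ wlpI pv(2)] pred) simp_all
    then show "hole_inst d s (?t s) \<and> shape (?t s) = shape (While qs B (Hole ?F))" by (simp add: PQ)
  qed (use B in \<open>simp_all add: split_beta\<close>)
  also have "(refine_par d)\<^sup>*\<^sup>* (While qs B (Hole ?F)) ?W"
  proof (intro refine_while While.IH)
    show "valid_family d ?F S"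
      using pred valid_par_compose[OF wlpI wlpR] by (auto simp: valid_family_def)
  qed (use While.prems in simp_all)
  finally show ?case .
qed simp

theorem mainTheorem3:
  fixes d :: "'v::finite \<Rightarrow> nat"
    and P Q :: "'v op"
    and S :: "'v prog"
  assumes "\<forall>q. 0 < d q"
    and "is_pred d P" and "is_pred d Q"
    and "concrete S" and "wf_prog d S"
    and "valid_par d P S Q"
  shows "(refine_par d)\<^sup>*\<^sup>* (Hole {(P, Q)}) S"
  using assms by (intro refine_family) (auto simp: valid_family_def)

end
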